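(* Let $G$ be a group. Then $\mathcal{P}^*(G)$ is maximal planar if and only if $G$ is a cyclic group of order at most five.
   Context: The proper power graph $\mathcal{P}^*(G)$ of a group $G$ is the simple graph whose vertex set is $G\setminus\{1\}$, in which two distinct vertices $x,y$ are adjacent if and only if $x\in\langle y\rangle$ or $y\in\langle x\rangle$. A simple graph is maximal planar if it is planar but the graph obtained by adding any new edge (between two nonadjacent distinct vertices) is not planar. *)

theory Defs
  imports "HOL-Analysis.Analysis" "HOL-Algebra.Algebra"
begin

record 'a ugraph =
  uverts :: "'a set"
  uedges :: "'a set set"

definition simple_graph :: "'a ugraph \<Rightarrow> bool" where
  "simple_graph H \<longleftrightarrow> (\<forall>e\<in>uedges H. e \<subseteq> uverts H \<and> card e = 2)"

text \<open>
  A drawing in the Euclidean plane (the type \<^typ>\<open>complex\<close>) places the vertices at distinct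
  points and represents every edge by an arc between its two end vertices; the interior of that
  arc contains no vertex and no point of any other edge. The graph may be infinite: no
  discreteness or local finiteness of the drawing is required.
\<close>

definition plane_drawing :: "'a ugraph \<Rightarrow> ('a \<Rightarrow> complex) \<Rightarrow> ('a set \<Rightarrow> real \<Rightarrow> complex) \<Rightarrow> bool" where
  "plane_drawing H p \<gamma> \<longleftrightarrow>
     inj_on p (uverts H) \<and>
     (\<forall>e\<in>uedges H. arc (\<gamma> e) \<and> {pathstart (\<gamma> e), pathfinish (\<gamma> e)} = p ` e) \<and>
     (\<forall>e\<in>uedges H. (path_image (\<gamma> e) - p ` e) \<inter> p ` uverts H = {}) \<and>
     (\<forall>e\<in>uedges H. \<forall>f\<in>uedges H. e \<noteq> f \<longrightarrow> (path_image (\<gamma> e) - p ` e) \<inter> path_image (\<gamma> f) = {})"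

definition planar_graph :: "'a ugraph \<Rightarrow> bool" where
  "planar_graph H \<longleftrightarrow> simple_graph H \<and> (\<exists>p \<gamma>. plane_drawing H p \<gamma>)"

definition add_edge :: "'a \<Rightarrow> 'a \<Rightarrow> 'a ugraph \<Rightarrow> 'a ugraph" where
  "add_edge x y H = H\<lparr>uedges := insert {x, y} (uedges H)\<rparr>"

definition maximal_planar :: "'a ugraph \<Rightarrow> bool" where
  "maximal_planar H \<longleftrightarrow> planar_graph H \<and>
     (\<forall>x\<in>uverts H. \<forall>y\<in>uverts H.
        x \<noteq> y \<and> {x, y} \<notin> uedges H \<longrightarrow> \<not> planar_graph (add_edge x y H))"

definition proper_power_graph :: "('a, 'b) monoid_scheme \<Rightarrow> 'a ugraph" where
  "proper_power_graph G =
     \<lparr>uverts = carrier G - {\<one>\<^bsub>G\<^esub>},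
      uedges = {{x, y} | x y. x \<in> carrier G - {\<one>\<^bsub>G\<^esub>} \<and> y \<in> carrier G - {\<one>\<^bsub>G\<^esub>} \<and> x \<noteq> y \<and>
                       (x \<in> generate G {y} \<or> y \<in> generate G {x})}\<rparr>"

lemma simple_graph_proper_power_graph: "simple_graph (proper_power_graph G)"
  by (auto simp: simple_graph_def proper_power_graph_def card_2_iff)

lemma simple_graph_add_edge:
  assumes "simple_graph H" "x \<in> uverts H" "y \<in> uverts H" "x \<noteq> y"
  shows "simple_graph (add_edge x y H)"
  using assms by (auto simp: simple_graph_def add_edge_def)

end

theory Submission
  imports Defs
begin

text \<open>
  Given an arc \<open>\<alpha>\<close> from \<open>P\<close> to \<open>Q\<close>, the function \<open>(z - P) / (z - Q)\<close> has a continuous logarithm off \<open>\<alpha>\<close>,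
  which slits the plane open along \<open>\<alpha>\<close>. After this redrawing, a parallel copy of a path \<open>v a w\<close> can be
  added to any drawing, however wild, as long as the remaining edges at \<open>a\<close> leave on one side. This
  gives enough operations (adding a vertex along an edge, joining two neighbours of a vertex of degree
  at most 3) to handle infinite graphs.

  Since \<open>K\<^sub>5\<close> is not planar, planarity of the power graph bounds element orders by 6. An element \<open>a\<close> of
  order 6 lets one join \<open>a^3\<close> to \<open>a^2\<close> or to \<open>a^4\<close>. If \<open>d\<close> has order 4 and \<open>d^2\<close> has a neighbour \<open>y\<close> outside
  \<open>\<langle>d\<rangle>\<close>, then \<open>d\<close> and its inverse can be redrawn along the edge \<open>d^2 y\<close> so that \<open>d\<close> is adjacent to \<open>y\<close>.
  Otherwise the components are cliques with at most four vertices, and if there are two of them, one can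
  be redrawn next to an edge of the other. So a maximal planar power graph is complete, and the group is
  generated by any element of maximal order.
\<close>

section \<open>Slitting the plane along an arc\<close>

text \<open>Sliding \<open>P\<close> along the path deforms the quotient to the constant 1 within the punctured plane.\<close>

lemma continuous_log_quotient:
  fixes S :: "complex set"
  assumes g: "path g" "pathstart g = P" "pathfinish g = Q" and gS: "path_image g \<inter> S = {}"
  obtains h where "continuous_on S h" "\<And>z. z \<in> S \<Longrightarrow> exp (h z) = (z - P) / (z - Q)"
proof -
  have ne: "z \<noteq> g s" if "z \<in> S" "s \<in> {0..1}" for z s
    using gS that unfolding path_image_def by blast
  have Q: "z \<noteq> Q" if "z \<in> S" for z
    using ne[OF that, of 1] g(3) by (simp add: pathfinish_def)
  have cg: "continuous_on {0..1} g" using g(1) by (simp add: path_def)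
  define H where "H = (\<lambda>y :: real \<times> complex. (snd y - g (fst y)) / (snd y - Q))"
  have H1: "continuous_on ({0..1} \<times> S) H"
    unfolding H_def by (intro continuous_intros continuous_on_compose2[OF cg]) (auto simp: Q)
  have H2: "H \<in> {0..1} \<times> S \<rightarrow> - {0}"
  proof
    fix y :: "real \<times> complex" assume "y \<in> {0..1} \<times> S"
    then have y: "snd y \<in> S" "fst y \<in> {0..1}" by auto
    have "snd y - g (fst y) \<noteq> 0" "snd y - Q \<noteq> 0" using ne[OF y] Q[OF y(1)] by simp_all
    then show "H y \<in> - {0}" by (simp add: H_def)
  qed
  have H3: "H (0, x) = (x - P) / (x - Q)" "H (1, x) = 1" if "x \<in> S" for x
    using g Q[OF that] by (simp_all add: H_def pathstart_def pathfinish_def)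
  have "continuous_map (top_of_set ({0..1} \<times> S)) (top_of_set (- {0})) H"
    by (rule iffD2[OF continuous_map_subtopology_eu], rule conjI[OF H1 H2])
  then have "continuous_map (prod_topology (top_of_set {0..1}) (top_of_set S)) (top_of_set (- {0})) H"
    by (simp only: prod_topology_subtopology_eu)
  then have "homotopic_with_canon (\<lambda>h. True) S (-{0}) (\<lambda>z. (z - P) / (z - Q)) (\<lambda>z. 1)"
    using H3 by (subst homotopic_with) auto
  from iffD1[OF inessential_eq_continuous_logarithm, OF exI, OF this]
  obtain h where "continuous_on S h" "\<forall>x\<in>S. (x - P) / (x - Q) = exp (h x)" by (elim exE conjE)
  then show ?thesis using that by simp
qed

text \<open>The difference takes values among the integer multiples of \<open>2 * pi * \<i>\<close>.
  Distinct ones are at least \<open>2 * pi\<close> apart, so a continuous choice on a connected set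
  cannot change.\<close>

lemma continuous_logs_differ_by_constant:
  fixes h k :: "complex \<Rightarrow> complex"
  assumes "connected S" and h: "continuous_on S h" and k: "continuous_on S k"
    and e: "\<And>z. z \<in> S \<Longrightarrow> exp (h z) = exp (k z)"
  obtains c where "exp c = 1" "\<And>z. z \<in> S \<Longrightarrow> h z = k z + c"
proof -
  have "(\<lambda>z. h z - k z) constant_on S"
  proof (rule continuous_discrete_range_constant[OF \<open>connected S\<close>])
    show "continuous_on S (\<lambda>z. h z - k z)" by (intro continuous_intros h k)
    fix x assume x: "x \<in> S"
    have "2 * pi \<le> norm ((h y - k y) - (h x - k x))" if y: "y \<in> S" "h y - k y \<noteq> h x - k x" for y
    proof -
      have "exp (h y - k y) = exp (h x - k x)" using e[OF x] e[OF y(1)] by (simp add: exp_diff)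
      then obtain n :: int where n: "h y - k y = h x - k x + (of_int (2 * n) * pi) * \<i>"
        using exp_eq by blast
      with y have "n \<noteq> 0" by auto
      then have "1 \<le> \<bar>real_of_int n\<bar>" by linarith
      then have "2 * pi \<le> \<bar>2 * real_of_int n * pi\<bar>" by (simp add: abs_mult)
      also have "\<dots> = norm ((h y - k y) - (h x - k x))" by (simp add: n norm_mult abs_mult)
      finally show ?thesis .
    qed
    then show "\<exists>e>0. \<forall>y. y \<in> S \<and> h y - k y \<noteq> h x - k x \<longrightarrow> e \<le> norm (h y - k y - (h x - k x))"
      by (intro exI[of _ "2 * pi"]) auto
  qed
  then obtain c where c: "\<And>z. z \<in> S \<Longrightarrow> h z - k z = c" unfolding constant_on_def by blast
  show ?thesis
  proof (cases "S = {}")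
    case True then show ?thesis using that[of 0] by simp
  next
    case False
    then obtain z where z: "z \<in> S" by blast
    have "exp c = exp (h z - k z)" using c[OF z] by simp
    also have "\<dots> = 1" using e[OF z] by (simp add: exp_diff)
    finally show ?thesis using that[of c] c by (metis add.commute diff_add_cancel)
  qed
qed

text \<open>A nonvanishing continuous function on a contractible set has a continuous logarithm. The
  open version serves \<open>(z - P) / (z - Q)\<close> on an arc from \<open>P\<close> to
  \<open>Q\<close>, where the quotient degenerates at both ends.\<close>

lemma contractible_arc_interior:
  fixes g :: "real \<Rightarrow> complex"
  assumes "arc g"
  shows "contractible (path_image g)" "contractible (path_image g - {pathstart g, pathfinish g})"
proof -
  obtain h where h: "homeomorphism {0..1} (path_image g) g h"
    using homeomorphism_arc[OF assms] .
  then show "contractible (path_image g)"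
    by (metis homeomorphic_contractible_eq homeomorphic_def convex_imp_contractible convex_real_interval(5))
  have inj: "inj_on g {0..1}" using assms by (simp add: arc_def)
  have "g ` {0<..<1} = path_image g - {pathstart g, pathfinish g}"
  proof -
    have "{0<..<1} = {0..1} - {0, 1::real}" by auto
    then have "g ` {0<..<1} = g ` {0..1} - g ` {0, 1}"
      using inj_on_image_set_diff[OF inj, of "{0..1}" "{0,1}"] by simp
    then show ?thesis by (simp add: path_image_def pathstart_def pathfinish_def)
  qed
  then have "homeomorphism {0<..<1} (path_image g - {pathstart g, pathfinish g}) g h"
    by (intro homeomorphism_of_subsets[OF h]) auto
  then show "contractible (path_image g - {pathstart g, pathfinish g})"
    by (metis homeomorphic_contractible_eq homeomorphic_def convex_imp_contractible convex_real_interval(8))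
qed

text \<open>\<open>squeeze\<close> embeds the plane in the lens with tips \<open>- pi/2\<close> and \<open>pi/2\<close>, which are approached as the
  real part tends to \<open>- \<infinity>\<close> and \<open>\<infinity>\<close>, uniformly in the imaginary part. In \<open>slit_map\<close> the function
  \<open>h\<close> is a branch of the logarithm of \<open>(z - P) / (z - Q)\<close>, so that \<open>P\<close> and \<open>Q\<close> go to the tips.\<close>

definition squeeze :: "complex \<Rightarrow> complex" where
  "squeeze w = Complex (arctan (Re w)) (cos (arctan (Re w)) * arctan (Im w))"

definition slit_map :: "complex \<Rightarrow> complex \<Rightarrow> (complex \<Rightarrow> complex) \<Rightarrow> complex \<Rightarrow> complex" where
  "slit_map P Q h z = (if z = P then - of_real (pi / 2) else if z = Q then of_real (pi / 2) else squeeze (h z))"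

lemma squeeze_inj: "squeeze w = squeeze w' \<Longrightarrow> w = w'"
proof -
  assume e: "squeeze w = squeeze w'"
  then have 1: "Re w = Re w'" by (simp add: squeeze_def arctan_eq_iff)
  have "cos (arctan (Re w)) \<noteq> 0" by (simp add: cos_arctan_not_zero)
  then have "Im w = Im w'" using e 1 by (simp add: squeeze_def arctan_eq_iff)
  with 1 show ?thesis by (simp add: complex_eq_iff)
qed

lemma squeeze_neq: "squeeze w \<noteq> of_real (pi/2)" "squeeze w \<noteq> - of_real (pi/2)"
  using arctan_ubound[of "Re w"] arctan_lbound[of "Re w"] by (auto simp: squeeze_def complex_eq_iff)

lemma slit_map_endpoints:
  assumes "P \<noteq> Q"
  shows "slit_map P Q h z = slit_map P Q k P \<longleftrightarrow> z = P"
    and "slit_map P Q h z = slit_map P Q k Q \<longleftrightarrow> z = Q"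
proof -
  have ne: "complex_of_real (pi / 2) \<noteq> - complex_of_real (pi / 2)"
    by (simp add: complex_eq_iff)
  show "slit_map P Q h z = slit_map P Q k P \<longleftrightarrow> z = P"
    using assms ne squeeze_neq(2)[of "h z"] unfolding slit_map_def by metis
  show "slit_map P Q h z = slit_map P Q k Q \<longleftrightarrow> z = Q"
    using assms ne squeeze_neq(1)[of "h z"] unfolding slit_map_def by metis
qed

text \<open>The bound does not involve \<open>Im w\<close>. This matters near \<open>P\<close> and
  \<open>Q\<close>, where the imaginary part of a logarithm may be unbounded, as along a
  spiral.\<close>

lemma norm_squeeze_le:
  "norm (squeeze w - of_real x) \<le> \<bar>arctan (Re w) - x\<bar> + cos (arctan (Re w)) * (pi/2)"
proof -
  have c: "0 \<le> cos (arctan (Re w))" by (simp add: cos_arctan)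
  have "\<bar>arctan (Im w)\<bar> \<le> pi/2" using arctan_ubound[of "Im w"] arctan_lbound[of "Im w"] by auto
  then have "\<bar>Im (squeeze w - of_real x)\<bar> \<le> cos (arctan (Re w)) * (pi/2)"
    using mult_left_mono[OF _ c, of "\<bar>arctan (Im w)\<bar>" "pi/2"] c by (simp add: squeeze_def abs_mult)
  then show ?thesis using cmod_le[of "squeeze w - of_real x"] by (simp add: squeeze_def)
qed

lemma squeeze_tendsto:
  fixes h :: "complex \<Rightarrow> complex"
  assumes "filterlim (\<lambda>z. Re (h z)) at_bot F"
  shows "((\<lambda>z. squeeze (h z)) \<longlongrightarrow> - of_real (pi/2)) F"
proof -
  have a: "((\<lambda>z. arctan (Re (h z))) \<longlongrightarrow> - (pi/2)) F"
    using filterlim_compose[OF tendsto_arctan_at_bot assms] .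
  have c: "((\<lambda>z. cos (arctan (Re (h z)))) \<longlongrightarrow> cos (- (pi/2))) F"
    by (rule tendsto_cos[OF a])
  have "((\<lambda>z. \<bar>arctan (Re (h z)) - - (pi/2)\<bar> + cos (arctan (Re (h z))) * (pi/2)) \<longlongrightarrow> \<bar>- (pi/2) - - (pi/2)\<bar> + cos (- (pi/2)) * (pi/2)) F"
    by (intro tendsto_intros a c)
  then have z: "((\<lambda>z. \<bar>arctan (Re (h z)) - - (pi/2)\<bar> + cos (arctan (Re (h z))) * (pi/2)) \<longlongrightarrow> 0) F"
    by simp
  have "((\<lambda>z. squeeze (h z) - of_real (- (pi/2))) \<longlongrightarrow> 0) F"
    by (rule Lim_null_comparison[OF _ z]) (use norm_squeeze_le[of _ "- (pi/2)"] in simp)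
  then show ?thesis using LIM_zero_cancel by fastforce
qed

lemma squeeze_uminus: "squeeze (- w) = - squeeze w"
  by (simp add: squeeze_def complex_eq_iff arctan_minus)

lemma squeeze_tendsto':
  fixes h :: "complex \<Rightarrow> complex"
  assumes "filterlim (\<lambda>z. Re (h z)) at_top F"
  shows "((\<lambda>z. squeeze (h z)) \<longlongrightarrow> of_real (pi/2)) F"
proof -
  have "((\<lambda>z. squeeze (- h z)) \<longlongrightarrow> - of_real (pi/2)) F"
    by (rule squeeze_tendsto) (use assms in \<open>simp add: filterlim_uminus_at_bot\<close>)
  from tendsto_minus[OF this] show ?thesis by (simp add: squeeze_uminus)
qed

lemma continuous_on_squeeze [continuous_intros]:
  fixes h :: "complex \<Rightarrow> complex"
  shows "continuous_on S h \<Longrightarrow> continuous_on S (\<lambda>z. squeeze (h z))"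
  unfolding squeeze_def by (auto intro!: continuous_intros)

text \<open>The work is at the ends. At \<open>P\<close> the modulus of the quotient tends to 0, so
  \<open>Re (h z)\<close> tends to minus infinity and the value to the left tip of the lens; at
  \<open>Q\<close> the signs are reversed. Nothing is needed about \<open>Im (h z)\<close>.\<close>

lemma continuous_on_slit_map:
  assumes PQ: "P \<noteq> Q" and h: "continuous_on (S - {P, Q}) h"
    and e: "\<And>z. z \<in> S - {P, Q} \<Longrightarrow> exp (h z) = (z - P) / (z - Q)"
  shows "continuous_on S (slit_map P Q h)"
proof -
  let ?f = "slit_map P Q h"
  have R: "Re (h z) = ln (norm ((z - P) / (z - Q)))" if "z \<in> S - {P, Q}" for z
    using e[OF that] by (metis ln_exp norm_exp_eq_Re)
  have ev: "\<forall>\<^sub>F z in at x within S. z \<in> S - {P, Q}" if "x = P \<or> x = Q" for x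
  proof -
    have n: "\<forall>\<^sub>F z in at x within S. z \<noteq> y" for y
    proof (cases "y = x")
      case True then show ?thesis by (simp add: eventually_at_filter)
    next
      case False
      then have "\<forall>\<^sub>F z in nhds x. z \<in> - {y}" by (intro eventually_nhds_in_open) auto
      then show ?thesis unfolding eventually_at_filter by eventually_elim auto
    qed
    have "\<forall>\<^sub>F z in at x within S. z \<in> S" by (simp add: eventually_at_filter)
    with n[of P] n[of Q]
    show ?thesis by eventually_elim auto
  qed
  have "(?f \<longlongrightarrow> ?f x) (at x within S)" if x: "x \<in> S" for x
  proof (cases "x = P \<or> x = Q")
    case True
    have eq: "\<forall>\<^sub>F z in at x within S. ?f z = squeeze (h z)"
      using ev[OF True] by eventually_elim (auto simp: slit_map_def)
    have evR: "\<forall>\<^sub>F z in at x within S. ln (norm ((z - P) / (z - Q))) = Re (h z)"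
      using ev[OF True] by eventually_elim (use R in auto)
    show ?thesis
    proof (cases "x = P")
      case True
      have "filterlim (\<lambda>z. norm ((z - P) / (z - Q))) (nhds (norm ((P - P) / (P - Q)))) (at P within S)"
        using PQ by (intro tendsto_intros) auto
      moreover have "\<forall>\<^sub>F z in at P within S. norm ((z - P) / (z - Q)) \<in> {0<..}"
        using ev[OF disjI1, OF refl] by eventually_elim auto
      ultimately have "filterlim (\<lambda>z. norm ((z - P) / (z - Q))) (at_right 0) (at P within S)"
        by (intro tendsto_imp_filterlim_at_right) auto
      then have "filterlim (\<lambda>z. ln (norm ((z - P) / (z - Q)))) at_bot (at P within S)"
        by (rule filterlim_compose[OF ln_at_0])
      then have "filterlim (\<lambda>z. Re (h z)) at_bot (at x within S)"
        using filterlim_cong[OF refl refl evR] True by simp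
      then have "((\<lambda>z. squeeze (h z)) \<longlongrightarrow> ?f x) (at x within S)"
        using squeeze_tendsto True by (simp add: slit_map_def)
      then show ?thesis using tendsto_cong[OF eq] by simp
    next
      case False
      with True have xQ: "x = Q" by simp
      \<comment> \<open>At \<open>Q\<close> it is the reciprocal quotient that tends to 0; the minus
        sign below turns its logarithm back into \<open>Re (h z)\<close>.\<close>
      have "filterlim (\<lambda>z. norm ((z - Q) / (z - P))) (nhds (norm ((Q - Q) / (Q - P)))) (at Q within S)"
        using PQ by (intro tendsto_intros) auto
      moreover have "\<forall>\<^sub>F z in at Q within S. norm ((z - Q) / (z - P)) \<in> {0<..}"
        using ev[OF disjI2, OF refl] by eventually_elim auto
      ultimately have "filterlim (\<lambda>z. norm ((z - Q) / (z - P))) (at_right 0) (at Q within S)"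
        by (intro tendsto_imp_filterlim_at_right) auto
      then have "filterlim (\<lambda>z. ln (norm ((z - Q) / (z - P)))) at_bot (at Q within S)"
        by (rule filterlim_compose[OF ln_at_0])
      then have "filterlim (\<lambda>z. - ln (norm ((z - Q) / (z - P)))) at_top (at Q within S)"
        by (simp add: filterlim_uminus_at_top)
      moreover have "\<forall>\<^sub>F z in at Q within S. - ln (norm ((z - Q) / (z - P))) = Re (h z)"
        using ev[OF disjI2, OF refl] by eventually_elim (use R in \<open>auto simp: norm_divide ln_div\<close>)
      ultimately have "filterlim (\<lambda>z. Re (h z)) at_top (at x within S)"
        using filterlim_cong[OF refl refl] xQ by fastforce
      then have "((\<lambda>z. squeeze (h z)) \<longlongrightarrow> ?f x) (at x within S)"
        using squeeze_tendsto' xQ PQ by (simp add: slit_map_def)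
      then show ?thesis using tendsto_cong[OF eq] by simp
    qed
  next
    case False
    have "((\<lambda>z. squeeze (h z)) \<longlongrightarrow> squeeze (h x)) (at x within S - {P, Q})"
      using continuous_on_squeeze[OF h] x False by (auto simp: continuous_on)
    moreover have "at x within S - {P, Q} = at x within S"
      using False by (intro at_within_nhd[of _ "- {P, Q}"]) (auto simp: open_Compl)
    ultimately have "((\<lambda>z. squeeze (h z)) \<longlongrightarrow> ?f x) (at x within S)"
      using False by (simp add: slit_map_def)
    moreover have "\<forall>\<^sub>F z in at x within S. ?f z = squeeze (h z)"
    proof -
      have "\<forall>\<^sub>F z in nhds x. z \<in> - {P, Q}" using False by (intro eventually_nhds_in_open) (auto simp: open_Compl)
      then show ?thesis unfolding eventually_at_filter by eventually_elim (auto simp: slit_map_def)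
    qed
    ultimately show ?thesis using tendsto_cong by fastforce
  qed
  then show ?thesis by (simp add: continuous_on)
qed

text \<open>The two sides of \<open>\<alpha>\<close> correspond to two logarithms on \<open>\<alpha>\<close> that differ by \<open>2 * pi * \<i>\<close>.
  One of them agrees with the branch on the complement along \<open>T\<close> and carries \<open>\<alpha>\<close> itself, any other
  one carries the new arc.\<close>

lemma parallel_arc:
  fixes P :: complex
  assumes \<alpha>: "arc \<alpha>" "pathstart \<alpha> = P" "pathfinish \<alpha> = Q"
    and T: "T \<inter> path_image \<alpha> = {a}" "a \<noteq> P" "a \<noteq> Q" "connected (T - {a})"
    and g: "continuous_on T g" "\<And>z. z \<in> T \<Longrightarrow> exp (g z) = (z - P) / (z - Q)"
  obtains \<Psi> :: "complex \<Rightarrow> complex" and \<beta> where "inj \<Psi>" "continuous_on (- (path_image \<alpha> - {P, Q})) \<Psi>"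
    "continuous_on (path_image \<alpha>) \<Psi>" "continuous_on T \<Psi>"
    "arc \<beta>" "pathstart \<beta> = \<Psi> P" "pathfinish \<beta> = \<Psi> Q" "path_image \<beta> \<inter> range \<Psi> \<subseteq> {\<Psi> P, \<Psi> Q}"
proof -
  let ?K = "path_image \<alpha>" and ?f = "\<lambda>z. (z - P) / (z - Q)"
  have PQ: "P \<noteq> Q" using arc_distinct_ends[OF \<alpha>(1)] \<alpha> by auto
  have PK: "P \<in> ?K" "Q \<in> ?K" using \<alpha> by auto
  obtain L where L: "continuous_on (- ?K) L" "\<And>z. z \<in> - ?K \<Longrightarrow> exp (L z) = ?f z"
    using continuous_log_quotient[of \<alpha> P Q "- ?K"] \<alpha> arc_imp_path by auto
  obtain l where l: "continuous_on (?K - {P, Q}) l" "\<And>z. z \<in> ?K - {P, Q} \<Longrightarrow> ?f z = exp (l z)"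
  proof (rule continuous_logarithm_on_contractible)
    show "continuous_on (?K - {P, Q}) ?f" by (intro continuous_intros) auto
    show "contractible (?K - {P, Q})" using contractible_arc_interior(2)[OF \<alpha>(1)] \<alpha> by simp
  qed (use PQ in auto)
  have aT: "a \<in> T" "a \<in> ?K" using T by auto
  have TK: "T - {a} \<subseteq> - ?K" using T by auto
  obtain c where c: "exp c = 1" "\<And>z. z \<in> T - {a} \<Longrightarrow> L z = g z + c"
  proof (rule continuous_logs_differ_by_constant[OF T(4)])
    show "continuous_on (T - {a}) L" using L(1) TK continuous_on_subset by blast
    show "continuous_on (T - {a}) g" using g(1) continuous_on_subset by blast
    show "exp (L z) = exp (g z)" if "z \<in> T - {a}" for z using L(2) g(2) that TK by auto
  qed (rule that)
  \<comment> \<open>The constant gives \<open>l'\<close> the value \<open>g a + c\<close> at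
    \<open>a\<close>, and \<open>g + c\<close> equals \<open>L\<close> on the rest of
    \<open>T\<close>. So \<open>M\<close> below is continuous on \<open>T\<close> through
    \<open>a\<close>, although it jumps across the arc.\<close>
  define l' where "l' z = l z + (g a + c - l a)" for z
  have l': "continuous_on (?K - {P, Q}) l'" unfolding l'_def by (intro continuous_intros l)
  have el': "exp (l' z) = ?f z" if "z \<in> ?K - {P, Q}" for z
  proof -
    have "exp (g a + c - l a) = 1"
      using g(2)[of a] l(2)[of a] c(1) aT T PQ by (simp add: exp_diff exp_add)
    then show ?thesis using l(2)[OF that] by (simp add: l'_def exp_add)
  qed
  define M where "M z = (if z \<in> ?K then l' z else L z)" for z
  have eM: "exp (M z) = ?f z" if "z \<notin> {P, Q}" for z
    using that el'[of z] L(2)[of z] by (auto simp: M_def)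
  have finj: "z = w" if "?f z = ?f w" "z \<notin> {P,Q}" "w \<notin> {P,Q}" for z w
  proof -
    have "(z - P) * (w - Q) = (w - P) * (z - Q)" using that by (simp add: field_simps)
    then have "(z - w) * (P - Q) = 0" by (simp add: algebra_simps)
    then show ?thesis using PQ by simp
  qed
  define \<Psi> where "\<Psi> = slit_map P Q M"
  define N where "N z = l' z + 2 * pi * \<i>" for z
  define \<Phi> where "\<Phi> = slit_map P Q N"
  have eN: "exp (N z) = ?f z" if "z \<in> ?K - {P, Q}" for z
    using el'[OF that] by (simp add: N_def exp_add)
  have cN: "continuous_on (?K - {P, Q}) N" unfolding N_def by (intro continuous_intros l')
  have slit_inj: "inj_on (slit_map P Q h) S"
    if "\<And>z. z \<in> S - {P, Q} \<Longrightarrow> exp (h z) = ?f z" for h S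
  proof (rule inj_onI)
    fix z w assume zw: "z \<in> S" "w \<in> S" "slit_map P Q h z = slit_map P Q h w"
    show "z = w"
    proof (cases "z \<in> {P,Q} \<or> w \<in> {P,Q}")
      case True
      then show ?thesis using zw(3) slit_map_endpoints[OF PQ] by (metis insertE singletonD)
    next
      case False
      then have "h z = h w" using zw(3) squeeze_inj by (auto simp: slit_map_def)
      then show ?thesis using finj[of z w] that[of z] that[of w] False zw by auto
    qed
  qed
  show thesis
  proof (rule that[of \<Psi> "\<Phi> \<circ> \<alpha>"])
    show "inj \<Psi>" unfolding \<Psi>_def by (rule slit_inj) (use eM in auto)
    show "continuous_on (- (?K - {P, Q})) \<Psi>" unfolding \<Psi>_def
    proof (rule continuous_on_slit_map[OF PQ])
      have "- (?K - {P, Q}) - {P, Q} = - ?K" using PK by auto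
      moreover have "continuous_on (- ?K) M"
        using L(1) by (rule continuous_on_eq) (simp add: M_def)
      ultimately show "continuous_on (- (?K - {P, Q}) - {P, Q}) M" by simp
    qed (use eM in auto)
    show "continuous_on ?K \<Psi>" unfolding \<Psi>_def
    proof (rule continuous_on_slit_map[OF PQ])
      show "continuous_on (?K - {P, Q}) M"
        using l' by (rule continuous_on_eq) (simp add: M_def)
    qed (use eM in auto)
    show "continuous_on T \<Psi>" unfolding \<Psi>_def
    proof (rule continuous_on_slit_map[OF PQ])
      have "continuous_on T (\<lambda>z. g z + c)" by (intro continuous_intros g)
      then have "continuous_on T M"
      proof (rule continuous_on_eq)
        fix z assume z: "z \<in> T"
        show "g z + c = M z"
        proof (cases "z = a")
          case True then show ?thesis using aT by (simp add: M_def l'_def)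
        next
          case False then show ?thesis using z TK c(2)[of z] by (auto simp: M_def)
        qed
      qed
      then show "continuous_on (T - {P, Q}) M" using continuous_on_subset by blast
    qed (use eM in auto)
    have c\<Phi>: "continuous_on ?K \<Phi>" unfolding \<Phi>_def
      by (rule continuous_on_slit_map[OF PQ cN]) (use eN in auto)
    have i\<Phi>: "inj_on \<Phi> ?K" unfolding \<Phi>_def by (rule slit_inj) (use eN in auto)
    show "arc (\<Phi> \<circ> \<alpha>)"
      using \<alpha>(1) c\<Phi> i\<Phi> unfolding arc_def
      by (auto intro: path_continuous_image comp_inj_on simp: path_image_def)
    show "pathstart (\<Phi> \<circ> \<alpha>) = \<Psi> P" "pathfinish (\<Phi> \<circ> \<alpha>) = \<Psi> Q"
      using \<alpha> by (auto simp: pathstart_compose pathfinish_compose \<Phi>_def \<Psi>_def slit_map_def)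
    show "path_image (\<Phi> \<circ> \<alpha>) \<inter> range \<Psi> \<subseteq> {\<Psi> P, \<Psi> Q}"
    proof
      fix y assume "y \<in> path_image (\<Phi> \<circ> \<alpha>) \<inter> range \<Psi>"
      then obtain z w where z: "z \<in> ?K" "y = \<Phi> z" and w: "y = \<Psi> w"
        by (auto simp: path_image_compose)
      show "y \<in> {\<Psi> P, \<Psi> Q}"
      proof (cases "z \<in> {P,Q} \<or> w \<in> {P,Q}")
        case True
        then show ?thesis using z w PQ by (auto simp: \<Phi>_def \<Psi>_def slit_map_def)
      next
        case False
        \<comment> \<open>Taking exponentials forces \<open>z = w\<close>. But at a point of the arc
          \<open>M\<close> is \<open>l'\<close>, which differs from \<open>N\<close> by a full
          period, a contradiction.\<close>
        then have *: "N z = M w" using z w squeeze_inj by (auto simp: \<Phi>_def \<Psi>_def slit_map_def)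
        then have "?f z = ?f w" using eN[of z] eM[of w] z False by auto
        then have "z = w" using finj[of z w] False by auto
        then show ?thesis using * z by (simp add: N_def M_def)
      qed
    qed
  qed
qed

section \<open>Drawings\<close>

lemma connected_arc_minus_start:
  fixes g :: "real \<Rightarrow> complex"
  assumes "arc g"
  shows "connected (path_image g - {pathstart g})"
proof -
  have inj: "inj_on g {0..1}" and c: "continuous_on {0..1} g" using assms by (auto simp: arc_def path_def)
  have "{0<..1} = {0..1} - {0::real}" by auto
  then have "g ` {0<..1} = g ` {0..1} - g ` {0}"
    using inj_on_image_set_diff[OF inj, of "{0..1}" "{0}"] by simp
  then have "g ` {0<..1} = path_image g - {pathstart g}" by (simp add: path_image_def pathstart_def)
  moreover have "connected (g ` {0<..1})"
    by (intro connected_continuous_image continuous_on_subset[OF c]) auto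
  ultimately show ?thesis by simp
qed

locale drawing =
  fixes H :: "'a ugraph" and p :: "'a \<Rightarrow> complex" and \<gamma> :: "'a set \<Rightarrow> real \<Rightarrow> complex"
  assumes simple: "simple_graph H" and drawing: "plane_drawing H p \<gamma>"
begin

section \<open>Incidences in a fixed drawing, and redrawing by an injective map\<close>

abbreviation "V \<equiv> uverts H"
abbreviation "E \<equiv> uedges H"
abbreviation "I e \<equiv> path_image (\<gamma> e)"

lemma inj_p: "inj_on p V" using drawing by (simp add: plane_drawing_def)

lemma edgeD: "{x, y} \<in> E \<Longrightarrow> x \<in> V" "{x, y} \<in> E \<Longrightarrow> y \<in> V" "{x, y} \<in> E \<Longrightarrow> x \<noteq> y"
  using simple by (fastforce simp: simple_graph_def)+

lemma edge_subset: "e \<in> E \<Longrightarrow> e \<subseteq> V" using simple by (auto simp: simple_graph_def)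

lemma p_eq: "x \<in> V \<Longrightarrow> y \<in> V \<Longrightarrow> p x = p y \<longleftrightarrow> x = y"
  using inj_p by (auto dest: inj_onD)

text \<open>An edge is an unordered pair, while \<open>\<gamma>\<close> fixes a direction; reversing
  the path if necessary makes it start at the chosen end.\<close>

lemma edge_arc:
  assumes "{x, y} \<in> E"
  obtains g where "arc g" "pathstart g = p x" "pathfinish g = p y" "path_image g = I {x, y}"
proof -
  have g: "arc (\<gamma> {x, y})" "{pathstart (\<gamma> {x, y}), pathfinish (\<gamma> {x, y})} = {p x, p y}"
    using drawing assms by (auto simp: plane_drawing_def)
  show ?thesis
  proof (cases "pathstart (\<gamma> {x, y}) = p x")
    case True
    then have "pathfinish (\<gamma> {x, y}) = p y" using g(2) by (metis doubleton_eq_iff)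
    then show ?thesis using that g True by blast
  next
    case False
    then have "pathfinish (\<gamma> {x, y}) = p x" "pathstart (\<gamma> {x, y}) = p y" using g(2) by (metis doubleton_eq_iff)+
    then show ?thesis using that[of "reversepath (\<gamma> {x, y})"] g(1) by (simp add: arc_reversepath)
  qed
qed

lemma ends_in_image: "e \<in> E \<Longrightarrow> x \<in> e \<Longrightarrow> p x \<in> I e"
  using drawing unfolding plane_drawing_def
  by (metis imageI insert_iff pathfinish_in_path_image pathstart_in_path_image singletonD)

lemma vertex_in_image: "e \<in> E \<Longrightarrow> x \<in> V \<Longrightarrow> p x \<in> I e \<longleftrightarrow> x \<in> e"
proof
  assume e: "e \<in> E" and x: "x \<in> V" and "p x \<in> I e"
  moreover have "(I e - p ` e) \<inter> p ` V = {}" using drawing e by (auto simp: plane_drawing_def)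
  ultimately have "p x \<in> p ` e" by blast
  then show "x \<in> e" using edge_subset[OF e] x p_eq by (metis imageE subsetD)
qed (rule ends_in_image)

lemma edge_Int:
  assumes "e \<in> E" "f \<in> E" "e \<noteq> f"
  shows "I e \<inter> I f = p ` (e \<inter> f)"
proof
  have "(I e - p ` e) \<inter> I f = {}" "(I f - p ` f) \<inter> I e = {}"
    using drawing assms by (auto simp: plane_drawing_def)
  then have "I e \<inter> I f \<subseteq> p ` e \<inter> p ` f" by blast
  also have "\<dots> = p ` (e \<inter> f)"
    using inj_on_image_Int[OF inj_p] edge_subset assms by metis
  finally show "I e \<inter> I f \<subseteq> p ` (e \<inter> f)" .
  show "p ` (e \<inter> f) \<subseteq> I e \<inter> I f" using ends_in_image assms by auto
qed

lemma connected_edge: "e \<in> E \<Longrightarrow> connected (I e)"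
  using drawing by (auto simp: plane_drawing_def intro!: connected_path_image arc_imp_path)

lemma compact_edge: "e \<in> E \<Longrightarrow> compact (I e)"
  using drawing by (auto simp: plane_drawing_def intro!: compact_path_image arc_imp_path)

lemma connected_half_open_edge: "{x, y} \<in> E \<Longrightarrow> connected (I {x, y} - {p x})"
  by (metis edge_arc connected_arc_minus_start)

text \<open>Continuity is asked for on each edge separately, because the slit map jumps across the
  arc along which the plane is opened.\<close>

lemma plane_drawing_compose:
  assumes \<Psi>: "inj \<Psi>" "\<And>e. e \<in> E \<Longrightarrow> continuous_on (I e) \<Psi>"
  shows "plane_drawing H (\<Psi> \<circ> p) (\<lambda>e. \<Psi> \<circ> \<gamma> e)"
  unfolding plane_drawing_def
proof (intro conjI ballI impI)
  have i: "\<Psi> x = \<Psi> y \<longleftrightarrow> x = y" for x y using \<Psi>(1) by (auto dest: injD)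
  show "inj_on (\<Psi> \<circ> p) V" using inj_p i by (auto simp: inj_on_def)
  fix e assume e: "e \<in> E"
  have g: "arc (\<gamma> e)" "{pathstart (\<gamma> e), pathfinish (\<gamma> e)} = p ` e"
    "(I e - p ` e) \<inter> p ` V = {}"
    using drawing e by (auto simp: plane_drawing_def)
  show "arc (\<Psi> \<circ> \<gamma> e)" using g(1) \<Psi>(2)[OF e] i
    unfolding arc_def by (auto intro!: path_continuous_image simp: inj_on_def)
  show "{pathstart (\<Psi> \<circ> \<gamma> e), pathfinish (\<Psi> \<circ> \<gamma> e)} = (\<Psi> \<circ> p) ` e"
    using arg_cong[OF g(2), of "image \<Psi>"] by (simp add: pathstart_compose pathfinish_compose image_comp)
  show "(path_image (\<Psi> \<circ> \<gamma> e) - (\<Psi> \<circ> p) ` e) \<inter> (\<Psi> \<circ> p) ` V = {}"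
  proof -
    have "path_image (\<Psi> \<circ> \<gamma> e) - (\<Psi> \<circ> p) ` e = \<Psi> ` (I e - p ` e)"
      using \<Psi>(1) by (simp add: path_image_compose image_set_diff image_comp)
    moreover have "(\<Psi> \<circ> p) ` V = \<Psi> ` (p ` V)" by (simp add: image_comp)
    ultimately show ?thesis using g(3) image_Int[OF \<Psi>(1)] by (metis image_empty)
  qed
  fix f assume f: "f \<in> E" "e \<noteq> f"
  have "(I e - p ` e) \<inter> I f = {}" using drawing e f by (auto simp: plane_drawing_def)
  then show "(path_image (\<Psi> \<circ> \<gamma> e) - (\<Psi> \<circ> p) ` e) \<inter> path_image (\<Psi> \<circ> \<gamma> f) = {}"
    using i by (auto simp: path_image_compose)
qed

text \<open>\<open>T\<close> contains all further edges at \<open>a\<close>. As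
  \<open>T - {p a}\<close> is connected and one logarithm serves all of \<open>T\<close>, these
  edges leave the path \<open>v a w\<close> on a single side. The slit map of
  \<open>parallel_arc\<close> keeps them attached there, and the new arc takes the other
  side.\<close>

lemma planar_add_edge_parallel:
  assumes va: "{v, a} \<in> E" and aw: "{a, w} \<in> E" and vw: "v \<noteq> w" "{v, w} \<notin> E"
    and T: "T \<inter> (I {v, a} \<union> I {a, w}) = {p a}" "connected (T - {p a})"
    and g: "continuous_on T g" "\<And>z. z \<in> T \<Longrightarrow> exp (g z) = (z - p v) / (z - p w)"
    and other: "\<And>e. e \<in> E \<Longrightarrow> a \<in> e \<Longrightarrow> e \<noteq> {v, a} \<Longrightarrow> e \<noteq> {a, w} \<Longrightarrow> I e \<subseteq> T"
  shows "planar_graph (add_edge v w H)"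
proof -
  have V: "v \<in> V" "a \<in> V" "w \<in> V" "v \<noteq> a" "a \<noteq> w" using edgeD va aw by auto
  have ne: "{v, a} \<noteq> {a, w}" using V vw by (auto simp: doubleton_eq_iff)
  obtain g1 where g1: "arc g1" "pathstart g1 = p v" "pathfinish g1 = p a" "path_image g1 = I {v, a}"
    using edge_arc[OF va] .
  obtain g2 where g2: "arc g2" "pathstart g2 = p a" "pathfinish g2 = p w" "path_image g2 = I {a, w}"
    using edge_arc[OF aw] .
  have "{v, a} \<inter> {a, w} = {a}" using V vw by auto
  then have I: "I {v, a} \<inter> I {a, w} = {p a}" by (simp only: edge_Int[OF va aw ne] image_insert image_empty)
  have arc: "arc (g1 +++ g2)" using g1 g2 I by (intro arc_join) auto
  have pi: "path_image (g1 +++ g2) = I {v, a} \<union> I {a, w}" using g1 g2 by (simp add: path_image_join)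
  obtain \<Psi> :: "complex \<Rightarrow> complex" and \<beta> where \<Psi>: "inj \<Psi>"
    "continuous_on (- (path_image (g1 +++ g2) - {p v, p w})) \<Psi>"
    "continuous_on (path_image (g1 +++ g2)) \<Psi>" "continuous_on T \<Psi>"
    and \<beta>: "arc \<beta>" "pathstart \<beta> = \<Psi> (p v)" "pathfinish \<beta> = \<Psi> (p w)"
      "path_image \<beta> \<inter> range \<Psi> \<subseteq> {\<Psi> (p v), \<Psi> (p w)}"
  proof (rule parallel_arc[OF arc, of "p v" "p w" T "p a" g])
    show "T \<inter> path_image (g1 +++ g2) = {p a}" using T pi by simp
    show "p a \<noteq> p v" "p a \<noteq> p w" using V p_eq by auto
  qed (use g1 g2 T g in auto)
  have c: "continuous_on (I e) \<Psi>" if e: "e \<in> E" for e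
  proof (cases "e = {v, a} \<or> e = {a, w}")
    case True
    then show ?thesis using continuous_on_subset[OF \<Psi>(3)] pi by auto
  next
    case False
    show ?thesis
    proof (cases "a \<in> e")
      case True
      then show ?thesis using continuous_on_subset[OF \<Psi>(4)] other[OF e True] False by auto
    next
      case a: False
      \<comment> \<open>An edge that avoids \<open>a\<close> meets the path at most in
        \<open>p v\<close> and \<open>p w\<close>, and at these points the slit map is continuous
        from outside the path as well.\<close>
      have "I e \<inter> (I {v, a} \<union> I {a, w}) \<subseteq> {p v, p w}"
        using edge_Int[OF e va] edge_Int[OF e aw] False a by auto
      then show ?thesis using continuous_on_subset[OF \<Psi>(2)] pi by auto
    qed
  qed
  define q where "q = \<Psi> \<circ> p"
  define \<delta> where "\<delta> = (\<lambda>e. \<Psi> \<circ> \<gamma> e)"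
  have D: "plane_drawing H q \<delta>" using plane_drawing_compose[OF \<Psi>(1) c] by (simp add: q_def \<delta>_def)
  interpret D: drawing H q \<delta> using D simple by unfold_locales
  have r: "path_image (\<delta> e) \<subseteq> range \<Psi>" "q x \<in> range \<Psi>" for e x
    by (auto simp: \<delta>_def q_def path_image_compose)
  have \<beta>': "path_image \<beta> \<inter> range \<Psi> \<subseteq> {q v, q w}" "{pathstart \<beta>, pathfinish \<beta>} = {q v, q w}"
    using \<beta> by (auto simp: q_def)
  have "plane_drawing (add_edge v w H) q (\<delta>({v, w} := \<beta>))"
    unfolding plane_drawing_def
  proof (intro conjI ballI impI)
    show "inj_on q (uverts (add_edge v w H))" using D.inj_p by (simp add: add_edge_def)
    fix e assume "e \<in> uedges (add_edge v w H)"
    then have e: "e = {v, w} \<or> e \<in> E \<and> e \<noteq> {v, w}" using vw by (auto simp: add_edge_def)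
    have d: "arc (\<delta> e) \<and> {pathstart (\<delta> e), pathfinish (\<delta> e)} = q ` e \<and> (path_image (\<delta> e) - q ` e) \<inter> q ` V = {}"
      if "e \<in> E" using D that by (auto simp: plane_drawing_def)
    show "arc ((\<delta>({v, w} := \<beta>)) e)" using e d \<beta>(1) by auto
    show "{pathstart ((\<delta>({v, w} := \<beta>)) e), pathfinish ((\<delta>({v, w} := \<beta>)) e)} = q ` e"
      using e d \<beta>'(2) by auto
    show "(path_image ((\<delta>({v, w} := \<beta>)) e) - q ` e) \<inter> q ` uverts (add_edge v w H) = {}"
      using e
    proof
      assume "e = {v, w}"
      then show ?thesis using \<beta>'(1) r by auto
    qed (use d in \<open>auto simp: add_edge_def\<close>)
    fix f assume "f \<in> uedges (add_edge v w H)" and ef: "e \<noteq> f"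
    then have f: "f = {v, w} \<or> f \<in> E \<and> f \<noteq> {v, w}" using vw by (auto simp: add_edge_def)
    show "(path_image ((\<delta>({v, w} := \<beta>)) e) - q ` e) \<inter> path_image ((\<delta>({v, w} := \<beta>)) f) = {}"
    proof (cases "e = {v, w}")
      case True
      then have "path_image (\<delta> f) \<subseteq> range \<Psi>" "f \<noteq> {v, w}" using ef r by auto
      then have "(path_image \<beta> - {q v, q w}) \<inter> path_image (\<delta> f) = {}" using \<beta>'(1) by blast
      then show ?thesis using True \<open>f \<noteq> {v, w}\<close> by simp
    next
      case False
      then have eE: "e \<in> E" using e by auto
      show ?thesis
      proof (cases "f = {v, w}")
        case True
        have "(path_image (\<delta> e) - q ` e) \<inter> path_image \<beta> \<subseteq> {q v, q w}" using \<beta>'(1) r by blast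
        moreover have "q v \<notin> path_image (\<delta> e) - q ` e" "q w \<notin> path_image (\<delta> e) - q ` e"
          using d[OF eE] V by auto
        ultimately show ?thesis using True False by auto
      next
        case False
        then have "f \<in> E" using f by simp
        then have "(path_image (\<delta> e) - q ` e) \<inter> path_image (\<delta> f) = {}"
          using D eE ef unfolding plane_drawing_def by simp
        then show ?thesis using False \<open>e \<noteq> {v, w}\<close> by simp
      qed
    qed
  qed
  moreover have "simple_graph (add_edge v w H)" by (rule simple_graph_add_edge[OF simple V(1,3) vw(1)])
  ultimately show ?thesis unfolding planar_graph_def by blast
qed

section \<open>Triangles, the Jordan curve theorem and the complete graph on five vertices\<close>

definition tri :: "'a \<Rightarrow> 'a \<Rightarrow> 'a \<Rightarrow> complex set" where
  "tri x y z = I {x, y} \<union> I {y, z} \<union> I {x, z}"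

lemma compact_tri: "{x, y} \<in> E \<Longrightarrow> {y, z} \<in> E \<Longrightarrow> {x, z} \<in> E \<Longrightarrow> compact (tri x y z)"
  by (simp add: tri_def compact_edge compact_Un)

lemma vertex_in_tri:
  "{x, y} \<in> E \<Longrightarrow> {y, z} \<in> E \<Longrightarrow> {x, z} \<in> E \<Longrightarrow> v \<in> V \<Longrightarrow> p v \<in> tri x y z \<longleftrightarrow> v \<in> {x, y, z}"
  by (auto simp: tri_def vertex_in_image)

lemma edge_Int_tri:
  assumes "{x, y} \<in> E" "{y, z} \<in> E" "{x, z} \<in> E" "{v, w} \<in> E" "v \<notin> {x, y, z}"
  shows "I {v, w} \<inter> tri x y z = p ` ({w} \<inter> {x, y, z})"
proof -
  have "{v, w} \<noteq> {x, y}" "{v, w} \<noteq> {y, z}" "{v, w} \<noteq> {x, z}"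
    using assms(5) by (auto simp: doubleton_eq_iff)
  then have "I {v, w} \<inter> tri x y z = p ` ({v, w} \<inter> {x, y}) \<union> p ` ({v, w} \<inter> {y, z}) \<union> p ` ({v, w} \<inter> {x, z})"
    using edge_Int assms unfolding tri_def by (simp add: Int_Un_distrib)
  also have "\<dots> = p ` ({w} \<inter> {x, y, z})" using assms(5) by auto
  finally show ?thesis .
qed

text \<open>\<open>W\<close> is the component of the complement of the triangle that does not contain \<open>q\<close>.\<close>

lemma opposite_side:
  assumes E: "{x, y} \<in> E" "{y, z} \<in> E" "{x, z} \<in> E" and q: "q \<notin> tri x y z"
  obtains W where "connected W" "W \<noteq> {}" "tri x y z \<subseteq> closure W"
    "\<forall>r. r \<in> W \<longleftrightarrow> r \<notin> tri x y z \<and> \<not> connected_component (- tri x y z) q r"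
proof -
  have ne: "x \<noteq> y" "y \<noteq> z" "x \<noteq> z" using edgeD E by auto
  obtain g1 where g1: "arc g1" "pathstart g1 = p x" "pathfinish g1 = p y" "path_image g1 = I {x, y}"
    using edge_arc[OF E(1)] .
  obtain g2 where g2: "arc g2" "pathstart g2 = p y" "pathfinish g2 = p z" "path_image g2 = I {y, z}"
    using edge_arc[OF E(2)] .
  have zx: "{z, x} = {x, z}" by auto
  then have "{z, x} \<in> E" using E(3) by simp
  then obtain g3 where g3: "arc g3" "pathstart g3 = p z" "pathfinish g3 = p x" "path_image g3 = I {x, z}"
    unfolding zx[symmetric] by (rule edge_arc)
  have "{x, y} \<noteq> {y, z}" "{x, y} \<noteq> {x, z}" "{y, z} \<noteq> {x, z}" using ne by (auto simp: doubleton_eq_iff)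
  moreover have "{x, y} \<inter> {y, z} = {y}" "{x, y} \<inter> {x, z} = {x}" "{y, z} \<inter> {x, z} = {z}" using ne by auto
  ultimately have i12: "I {x, y} \<inter> I {y, z} = {p y}" and i13: "I {x, y} \<inter> I {x, z} = {p x}" and i23: "I {y, z} \<inter> I {x, z} = {p z}"
    by (simp_all only: edge_Int[OF E(1,2)] edge_Int[OF E(1,3)] edge_Int[OF E(2,3)] image_insert image_empty simp_thms)
  have a12: "arc (g1 +++ g2)" using g1 g2 i12 by (intro arc_join) auto
  have s: "simple_path ((g1 +++ g2) +++ g3)"
    using g1 g2 g3 i13 i23 by (intro simple_path_join_loop a12) (auto simp: path_image_join)
  have pi: "path_image ((g1 +++ g2) +++ g3) = tri x y z"
    using g1 g2 g3 by (simp add: path_image_join tri_def)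
  have cl: "pathfinish ((g1 +++ g2) +++ g3) = pathstart ((g1 +++ g2) +++ g3)"
    using g1 g3 by simp
  define A B where "A = inside (tri x y z)" and "B = outside (tri x y z)"
  have J: "A \<noteq> {}" "open A" "connected A" "B \<noteq> {}" "open B" "connected B" "A \<inter> B = {}"
    "A \<union> B = - tri x y z" "frontier A = tri x y z" "frontier B = tri x y z"
    using Jordan_inside_outside[OF s cl] unfolding pi A_def B_def by auto
  note result = that
  \<comment> \<open>The point \<open>q\<close> may be inside or outside the triangle. Here
    \<open>A\<close> stands for its side and \<open>B\<close> for the other one; both assignments
    are used at the end.\<close>
  have *: thesis if "q \<in> A" "open A" "connected A" "connected B" "B \<noteq> {}" "open B" "A \<inter> B = {}"
    and AB: "A \<union> B = - tri x y z" and fr: "frontier B = tri x y z" for A B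
  proof (rule result[of B])
    show "tri x y z \<subseteq> closure B" using fr by (auto simp: frontier_def)
    show "\<forall>r. r \<in> B \<longleftrightarrow> r \<notin> tri x y z \<and> \<not> connected_component (- tri x y z) q r"
    proof
      fix r
      show "r \<in> B \<longleftrightarrow> r \<notin> tri x y z \<and> \<not> connected_component (- tri x y z) q r"
      proof
        assume r: "r \<in> B"
        have "\<not> connected_component (- tri x y z) q r"
        proof
          assume "connected_component (- tri x y z) q r"
          then obtain C where "connected C" "C \<subseteq> A \<union> B" "q \<in> C" "r \<in> C"
            unfolding connected_component_def AB by blast
          then show False using connectedD[of C A B] that AB r by blast
        qed
        then show "r \<notin> tri x y z \<and> \<not> connected_component (- tri x y z) q r" using r AB by auto
      next
        assume "r \<notin> tri x y z \<and> \<not> connected_component (- tri x y z) q r"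
        moreover have "connected_component (- tri x y z) q r" if "r \<in> A"
          using \<open>connected A\<close> \<open>q \<in> A\<close> that \<open>A \<union> B = - tri x y z\<close> unfolding connected_component_def by blast
        ultimately show "r \<in> B" using AB by auto
      qed
    qed
  qed (use that in auto)
  have "q \<in> A \<or> q \<in> B" using q J(8) by auto
  then show thesis using *[of A B] *[of B A] J by (auto simp: Int_commute Un_commute)
qed

lemma connected_insert_closure:
  "connected W \<Longrightarrow> q \<in> closure W \<Longrightarrow> connected (insert q W)" for W :: "complex set"
  by (rule connected_intermediate_closure[of W]) (use closure_subset in auto)

text \<open>Choose \<open>s\<close> on the side of the triangle \<open>abc\<close> opposite to \<open>e\<close>. For each of the other three
  triangles of \<open>abcd\<close>, neither \<open>s\<close> nor \<open>e\<close> is separated from the missing vertex, hence by Janiszewski's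
  theorem the union of the three triangles does not separate \<open>s\<close> from \<open>e\<close> either.\<close>

lemma no_K5:
  assumes E: "{a, b} \<in> E" "{a, c} \<in> E" "{a, d} \<in> E" "{a, e} \<in> E" "{b, c} \<in> E" "{b, d} \<in> E" "{b, e} \<in> E"
    "{c, d} \<in> E" "{c, e} \<in> E" "{d, e} \<in> E"
  shows False
proof -
  note ne = E[THEN edgeD(3)] and V = E[THEN edgeD(1)] E[THEN edgeD(2)]
  have E': "{b, a} \<in> E" "{c, a} \<in> E" "{d, a} \<in> E" "{e, a} \<in> E" "{c, b} \<in> E" "{d, b} \<in> E" "{e, b} \<in> E"
    "{d, c} \<in> E" "{e, c} \<in> E" "{e, d} \<in> E" using E by (simp_all add: insert_commute)
  have pe: "p e \<notin> tri a b c" using vertex_in_tri E V ne by auto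
  obtain W where W: "connected W" "W \<noteq> {}" "tri a b c \<subseteq> closure W"
    "\<forall>r. r \<in> W \<longleftrightarrow> r \<notin> tri a b c \<and> \<not> connected_component (- tri a b c) (p e) r"
    using opposite_side[OF E(1) E(5) E(2) pe] .
  then obtain s where s: "s \<in> W" by blast
  note W4 = W(4)[rule_format]
  have Wtri: "W \<inter> tri a b c = {}" using W4 by blast
  \<comment> \<open>The edge \<open>{d, e}\<close> avoids the triangle, so \<open>d\<close> is on
    the side of \<open>e\<close>, and so are the edges from \<open>d\<close> up to their ends on the
    triangle. \<open>W\<close> is the other side.\<close>
  have Wd: "W \<inter> I {x, d} = {}" if x: "x \<in> {a, b, c}" for x
  proof -
    have xd: "{x, d} \<in> E" "{d, x} \<in> E" using x E E' by auto
    have de: "I {d, e} \<inter> tri a b c = {}" using edge_Int_tri[OF E(1) E(5) E(2) E(10)] ne by auto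
    have dx: "I {d, x} \<inter> tri a b c = {p x}" using edge_Int_tri[OF E(1) E(5) E(2) xd(2)] ne x by auto
    have "x \<noteq> d" using edgeD xd by blast
    then have pd: "p d \<in> I {x, d} - {p x}" "p d \<in> I {d, e}"
      using ends_in_image xd E(10) p_eq V x by auto
    have "connected ((I {x, d} - {p x}) \<union> I {d, e})"
      using connected_Un[OF connected_half_open_edge[OF xd(1)] connected_edge[OF E(10)]] pd by blast
    moreover have "(I {x, d} - {p x}) \<union> I {d, e} \<subseteq> - tri a b c" using de dx by (auto simp: insert_commute)
    moreover have "p e \<in> I {d, e}" using ends_in_image E(10) by auto
    ultimately have "connected_component (- tri a b c) (p e) r" if "r \<in> I {x, d} - {p x}" for r
      using that unfolding connected_component_def by blast
    then have "W \<inter> (I {x, d} - {p x}) = {}" using W4 by fast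
    moreover have "p x \<in> tri a b c"
      using x vertex_in_tri[OF E(1) E(5) E(2) edgeD(1)[OF xd(1)]] by simp
    ultimately show ?thesis using Wtri by blast
  qed
  have Wt: "W \<inter> I {a, b} = {}" "W \<inter> I {b, c} = {}" "W \<inter> I {a, c} = {}" using Wtri by (auto simp: tri_def)
  \<comment> \<open>\<open>v\<close> is the vertex of \<open>a b c\<close> missing from the triangle
    \<open>x y d\<close>. The point \<open>s\<close> reaches \<open>p v\<close> through
    \<open>W\<close>, whose closure contains \<open>p v\<close>; the edge \<open>{v, e}\<close>
    leads on to \<open>p e\<close>.\<close>
  have cc: "connected_component (- tri x y d) (p e) s"
    if "{x, y, v} = {a, b, c}" "{x, y} \<in> E" "{y, d} \<in> E" "{x, d} \<in> E" "{v, e} \<in> E" "v \<notin> {x, y, d}" "e \<notin> {x, y, d}" "v \<in> V" for x y v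
  proof -
    have vabc: "v \<in> {a, b, c}" and xy: "x \<in> {a, b, c}" "y \<in> {a, b, c}" using that(1) by auto
    have "W \<inter> I {x, y} = {}" using Wt xy edgeD(3)[OF that(2)] by (auto simp: insert_commute)
    then have "insert (p v) W \<subseteq> - tri x y d"
      using Wd[OF xy(1)] Wd[OF xy(2)] vertex_in_tri[OF that(2,3,4,8)] that(6) by (auto simp: tri_def)
    moreover have "connected (insert (p v) W)"
      using W(1,3) vabc vertex_in_tri[OF E(1) E(5) E(2)] V by (intro connected_insert_closure) auto
    ultimately have 1: "connected_component (- tri x y d) (p v) s"
      using s unfolding connected_component_def by blast
    have "I {v, e} \<subseteq> - tri x y d" using edge_Int_tri[OF that(2,3,4,5,6)] that(7) by auto
    then have "connected_component (- tri x y d) (p e) (p v)"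
      using connected_edge[OF that(5)] ends_in_image[OF that(5)] unfolding connected_component_def by blast
    then show ?thesis using 1 connected_component_trans by metis
  qed
  have ca: "connected_component (- tri b c d) (p e) s" using cc[of b c a] E ne V by auto
  have cb: "connected_component (- tri a c d) (p e) s" using cc[of a c b] E ne V by auto
  have cab: "connected_component (- tri a b d) (p e) s" using cc[of a b c] E ne V by auto
  have cpt: "compact (tri b c d)" "compact (tri a c d)" "compact (tri a b d)" using compact_tri E by auto
  \<comment> \<open>Janiszewski's theorem requires a connected intersection: here it is one edge, in
    \<open>int2\<close> two edges that share \<open>d\<close>.\<close>
  have int1: "tri b c d \<inter> tri a c d = I {c, d}"
  proof -
    have "tri b c d \<inter> tri a c d = I {c, d} \<union> (I {b, c} \<inter> tri a c d) \<union> (I {b, d} \<inter> tri a c d)"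
      unfolding tri_def by blast
    also have "I {b, c} \<inter> tri a c d = {p c}" using edge_Int_tri[OF E(2) E(8) E(3) E(5)] ne by auto
    also have "I {b, d} \<inter> tri a c d = {p d}" using edge_Int_tri[OF E(2) E(8) E(3) E(6)] ne by auto
    finally show ?thesis using ends_in_image[OF E(8)] by auto
  qed
  have int2: "(tri b c d \<union> tri a c d) \<inter> tri a b d = I {b, d} \<union> I {a, d}"
  proof -
    have "(tri b c d \<union> tri a c d) \<inter> tri a b d
      = I {b, d} \<union> I {a, d} \<union> (I {c, b} \<inter> tri a b d) \<union> (I {c, d} \<inter> tri a b d) \<union> (I {c, a} \<inter> tri a b d)"
      unfolding tri_def by (auto simp: insert_commute)
    also have "I {c, b} \<inter> tri a b d = {p b}" using edge_Int_tri[OF E(1) E(6) E(3) E'(5)] ne by auto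
    also have "I {c, d} \<inter> tri a b d = {p d}" using edge_Int_tri[OF E(1) E(6) E(3) E(8)] ne by auto
    also have "I {c, a} \<inter> tri a b d = {p a}" using edge_Int_tri[OF E(1) E(6) E(3) E'(2)] ne by auto
    finally show ?thesis using ends_in_image[OF E(6)] ends_in_image[OF E(3)] by auto
  qed
  have cab': "connected_component (- (tri b c d \<union> tri a c d)) (p e) s"
    using Janiszewski[OF cpt(1) compact_imp_closed[OF cpt(2)] _ ca cb] int1 connected_edge[OF E(8)] by simp
  have "connected_component (- ((tri b c d \<union> tri a c d) \<union> tri a b d)) (p e) s"
  proof (rule Janiszewski[OF _ _ _ cab' cab])
    show "connected ((tri b c d \<union> tri a c d) \<inter> tri a b d)" unfolding int2
      using ends_in_image[OF E(6)] ends_in_image[OF E(3)]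
      by (intro connected_Un connected_edge E) auto
  qed (use cpt in \<open>auto intro: compact_imp_closed\<close>)
  \<comment> \<open>Every edge of \<open>a b c\<close> belongs to one of the three other triangles,
    so \<open>s\<close> and \<open>p e\<close> would not be separated by \<open>a b c\<close>,
    against the choice of \<open>s\<close>.\<close>
  moreover have "- ((tri b c d \<union> tri a c d) \<union> tri a b d) \<subseteq> - tri a b c"
    unfolding tri_def by (auto simp: insert_commute)
  ultimately have "connected_component (- tri a b c) (p e) s"
    using connected_component_of_subset by metis
  then show False using s W4 by blast
qed

text \<open>The side of \<open>abc\<close> containing \<open>t\<close> avoids the triangle \<open>abd\<close> and has \<open>c\<close> in its closure.\<close>

lemma same_side:
  assumes E: "{a, b} \<in> E" "{a, c} \<in> E" "{b, c} \<in> E" "{a, d} \<in> E" "{b, d} \<in> E"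
    and t: "t \<in> V" "t \<notin> {a, b, c, d}" and cd: "c \<noteq> d"
    and sep: "\<not> connected_component (- tri a b c) (p d) (p t)"
  shows "connected_component (- tri a b d) (p t) (p c)"
proof -
  note ne = E[THEN edgeD(3)] and V = E[THEN edgeD(1)] E[THEN edgeD(2)]
  have pd: "p d \<notin> tri a b c" using vertex_in_tri[OF E(1,3,2)] V ne cd by auto
  obtain W where W: "connected W" "W \<noteq> {}" "tri a b c \<subseteq> closure W"
    "\<forall>r. r \<in> W \<longleftrightarrow> r \<notin> tri a b c \<and> \<not> connected_component (- tri a b c) (p d) r"
    using opposite_side[OF E(1,3,2) pd] .
  note W4 = W(4)[rule_format]
  have Wtri: "W \<inter> tri a b c = {}" using W4 by blast
  have tW: "p t \<in> W" using W4 vertex_in_tri[OF E(1,3,2) t(1)] t sep by auto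
  \<comment> \<open>Apart from its end \<open>x\<close>, the edge to \<open>d\<close> avoids the
    triangle \<open>a b c\<close> and hence stays on the side of \<open>d\<close>, which is not
    \<open>W\<close>.\<close>
  have Wd: "W \<inter> I {x, d} = {}" if x: "x \<in> {a, b}" for x
  proof -
    have xd: "{x, d} \<in> E" "{d, x} \<in> E" using x E by (auto simp: insert_commute)
    have dx: "I {d, x} \<inter> tri a b c = {p x}" using edge_Int_tri[OF E(1,3,2) xd(2)] ne x cd by auto
    have "p d \<in> I {x, d} - {p x}" using ends_in_image[OF xd(1)] p_eq V x ne by auto
    moreover have "I {x, d} - {p x} \<subseteq> - tri a b c" using dx by (auto simp: insert_commute)
    ultimately have "connected_component (- tri a b c) (p d) r" if "r \<in> I {x, d} - {p x}" for r
      using that connected_half_open_edge[OF xd(1)] unfolding connected_component_def by blast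
    then have "W \<inter> (I {x, d} - {p x}) = {}" using W4 by fast
    moreover have "p x \<in> tri a b c"
      using x vertex_in_tri[OF E(1,3,2) edgeD(1)[OF xd(1)]] by auto
    ultimately show ?thesis using Wtri by blast
  qed
  have "W \<inter> I {a, b} = {}" using Wtri by (auto simp: tri_def)
  then have "insert (p c) W \<subseteq> - tri a b d"
    using Wd vertex_in_tri[OF E(1,5,4)] V ne cd by (auto simp: tri_def)
  moreover have "connected (insert (p c) W)"
    using W(1,3) vertex_in_tri[OF E(1,3,2)] V by (intro connected_insert_closure) auto
  ultimately show ?thesis using tW unfolding connected_component_def by blast
qed

end

section \<open>Operations on planar graphs\<close>

lemma planar_graphE:
  assumes "planar_graph H"
  obtains p \<gamma> where "drawing H p \<gamma>"
  using assms unfolding planar_graph_def drawing_def by blast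

lemma planar_subgraph:
  assumes "planar_graph H" "V \<subseteq> uverts H" "E \<subseteq> uedges H" "\<And>e. e \<in> E \<Longrightarrow> e \<subseteq> V"
  shows "planar_graph \<lparr>uverts = V, uedges = E\<rparr>"
proof -
  obtain p \<gamma> where "drawing H p \<gamma>" using planar_graphE[OF assms(1)] .
  then interpret drawing H p \<gamma> .
  have "plane_drawing \<lparr>uverts = V, uedges = E\<rparr> p \<gamma>"
    unfolding plane_drawing_def
  proof (intro conjI ballI impI)
    show "inj_on p (uverts \<lparr>uverts = V, uedges = E\<rparr>)" using inj_p assms(2) by (auto intro: inj_on_subset)
    fix e assume "e \<in> uedges \<lparr>uverts = V, uedges = E\<rparr>"
    then have e: "e \<in> uedges H" using assms(3) by auto
    have d: "arc (\<gamma> e)" "{pathstart (\<gamma> e), pathfinish (\<gamma> e)} = p ` e" "(I e - p ` e) \<inter> p ` uverts H = {}"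
      "\<And>f. f \<in> uedges H \<Longrightarrow> e \<noteq> f \<Longrightarrow> (I e - p ` e) \<inter> I f = {}"
      using drawing e unfolding plane_drawing_def by simp_all
    show "arc (\<gamma> e)" "{pathstart (\<gamma> e), pathfinish (\<gamma> e)} = p ` e" by fact+
    show "(I e - p ` e) \<inter> p ` uverts \<lparr>uverts = V, uedges = E\<rparr> = {}" using d(3) assms(2) by auto
    fix f assume "f \<in> uedges \<lparr>uverts = V, uedges = E\<rparr>" "e \<noteq> f"
    then show "(I e - p ` e) \<inter> I f = {}" using d(4)[of f] assms(3) by auto
  qed
  moreover have "simple_graph \<lparr>uverts = V, uedges = E\<rparr>"
    using simple assms(3,4) by (auto simp: simple_graph_def)
  ultimately show ?thesis unfolding planar_graph_def by blast
qed

context drawing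
begin

text \<open>The new vertex is the point of parameter \<open>1/2\<close> on the arc. However wild the
  drawing, the interior of an edge contains no vertex and no point of another edge.\<close>

lemma planar_subdivide:
  assumes vw: "{v, w} \<in> E" and x: "x \<notin> V"
  shows "planar_graph \<lparr>uverts = insert x V, uedges = insert {x, v} (insert {x, w} (E - {{v, w}}))\<rparr>"
    (is "planar_graph ?H")
proof -
  have V: "v \<in> V" "w \<in> V" "v \<noteq> w" "x \<noteq> v" "x \<noteq> w" using edgeD[OF vw] x by auto
  obtain g where g: "arc g" "pathstart g = p v" "pathfinish g = p w" "path_image g = I {v, w}"
    using edge_arc[OF vw] .
  define m where "m = g (1/2)"
  define A B where "A = path_image (subpath 0 (1/2) g)" and "B = path_image (subpath (1/2) 1 g)"
  have AB: "A = g ` {0..1/2}" "B = g ` {1/2..1}"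
    by (simp_all add: A_def B_def path_image_subpath)
  have inj: "inj_on g {0..1}" using g(1) by (simp add: arc_def)
  have "{0..1/2} \<union> {1/2..1} = {0..1::real}" "{0..1/2} \<inter> {1/2..1} = {1/2::real}" by auto
  then have "A \<union> B = I {v, w}" "A \<inter> B = {m}"
    using inj_on_image_Int[OF inj, of "{0..1/2}" "{1/2..1}"] g(4)
    by (auto simp: AB m_def path_image_def simp flip: image_Un)
  have g01: "g 0 = p v" "g 1 = p w" using g by (auto simp: pathstart_def pathfinish_def)
  have pvA: "p v \<in> A" "p w \<in> B" by (auto simp: AB simp flip: g01)
  have mne: "m \<noteq> p v" "m \<noteq> p w"
    using inj_onD[OF inj, of "1/2" 0] inj_onD[OF inj, of "1/2" 1] g01 by (auto simp: m_def)
  have pvB: "p v \<notin> B" "p w \<notin> A" using \<open>A \<inter> B = {m}\<close> pvA mne by auto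
  have mV: "m \<notin> p ` V"
  proof
    assume "m \<in> p ` V"
    then obtain y where y: "y \<in> V" "m = p y" by auto
    have "m \<in> I {v, w}" using \<open>A \<inter> B = {m}\<close> \<open>A \<union> B = I {v, w}\<close> by auto
    then show False using y vertex_in_image[OF vw y(1)] mne by auto
  qed
  define q where "q = p(x := m)"
  have q: "q x = m" "q v = p v" "q w = p w" "\<And>y. y \<in> V \<Longrightarrow> q y = p y" using V x by (auto simp: q_def)
  have qe: "q ` e = p ` e" if "e \<in> E" for e using q(4) edge_subset[OF that] by (intro image_cong) auto
  define \<delta> where "\<delta> e = (if e = {x, v} then subpath 0 (1/2) g else if e = {x, w} then subpath (1/2) 1 g else \<gamma> e)" for e
  have xe: "e \<noteq> {x, v}" "e \<noteq> {x, w}" if "e \<in> E" for e using edge_subset[OF that] x by auto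
  have \<delta>: "\<delta> {x, v} = subpath 0 (1/2) g" "\<delta> {x, w} = subpath (1/2) 1 g" "\<And>e. e \<in> E \<Longrightarrow> \<delta> e = \<gamma> e"
    using V xe by (auto simp: \<delta>_def doubleton_eq_iff)
  note J = \<delta>[THEN arg_cong[of _ _ path_image], folded A_def B_def]
  have qV: "q ` insert x V = insert m (p ` V)"
  proof -
    have "q ` V = p ` V" using q(4) by (intro image_cong) auto
    then show ?thesis using q(1) by simp
  qed
  have fI: "I f \<inter> I {v, w} \<subseteq> {p v, p w}" if "f \<in> E - {{v, w}}" for f
    using edge_Int[of f "{v, w}"] that vw by auto
  have vI: "I {v, w} \<inter> p ` V \<subseteq> {p v, p w}" using vertex_in_image[OF vw] by auto
  have cases: "P e" if "e \<in> uedges ?H" "P {x, v}" "P {x, w}" "\<And>e. e \<in> E \<Longrightarrow> e \<noteq> {v, w} \<Longrightarrow> P e" for P e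
    using that by auto
  have "plane_drawing ?H q \<delta>"
    unfolding plane_drawing_def
  proof (intro conjI ballI impI)
    have "inj_on q V" using inj_p q(4) by (simp add: inj_on_def)
    moreover have "q x \<notin> q ` V"
    proof -
      have "q ` V = p ` V" using q(4) by (intro image_cong) auto
      then show ?thesis using q(1) mV by simp
    qed
    ultimately show "inj_on q (uverts ?H)" using x by simp
    fix e assume e: "e \<in> uedges ?H"
    show "arc (\<delta> e)" using e
      by (rule cases) (use g drawing \<delta> in \<open>auto intro!: arc_subpath_arc simp: plane_drawing_def\<close>)
    show "{pathstart (\<delta> e), pathfinish (\<delta> e)} = q ` e" using e
    proof (rule cases)
      fix e assume "e \<in> E" "e \<noteq> {v, w}"
      then show "{pathstart (\<delta> e), pathfinish (\<delta> e)} = q ` e"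
        using drawing \<delta>(3) qe unfolding plane_drawing_def by simp
    qed (auto simp: \<delta> q g01 m_def)
    have "(path_image (\<delta> e) - q ` e) \<inter> insert m (p ` V) = {}" using e
    proof (rule cases)
      fix e assume e: "e \<in> E" "e \<noteq> {v, w}"
      have "(I e - p ` e) \<inter> p ` V = {}" using drawing e unfolding plane_drawing_def by simp
      moreover have "m \<notin> I e" using fI[of e] e mne \<open>A \<inter> B = {m}\<close> \<open>A \<union> B = I {v, w}\<close> by blast
      ultimately show "(path_image (\<delta> e) - q ` e) \<inter> insert m (p ` V) = {}"
        using J(3)[OF e(1)] qe[OF e(1)] by auto
    next
      show "(path_image (\<delta> {x, v}) - q ` {x, v}) \<inter> insert m (p ` V) = {}"
        using J q vI pvB \<open>A \<union> B = I {v, w}\<close> by auto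
      show "(path_image (\<delta> {x, w}) - q ` {x, w}) \<inter> insert m (p ` V) = {}"
        using J q vI pvB \<open>A \<union> B = I {v, w}\<close> by auto
    qed
    then show "(path_image (\<delta> e) - q ` e) \<inter> q ` uverts ?H = {}" using qV by simp
    fix f assume f: "f \<in> uedges ?H" and ef: "e \<noteq> f"
    have xv: "(A - {m, p v}) \<inter> I f = {}" "(B - {m, p w}) \<inter> I f = {}" if "f \<in> E" "f \<noteq> {v, w}" for f
      using fI[of f] that pvB \<open>A \<union> B = I {v, w}\<close> by auto
    have vx: "(I e - p ` e) \<inter> A = {}" "(I e - p ` e) \<inter> B = {}" if "e \<in> E" "e \<noteq> {v, w}" for e
    proof -
      have "(I e - p ` e) \<inter> I {v, w} = {}" using drawing that vw unfolding plane_drawing_def by simp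
      then show "(I e - p ` e) \<inter> A = {}" "(I e - p ` e) \<inter> B = {}" using \<open>A \<union> B = I {v, w}\<close> by blast+
    qed
    have ee: "(I e - p ` e) \<inter> I f = {}" if "e \<in> E" "f \<in> E" "e \<noteq> f" for e f
      using drawing that unfolding plane_drawing_def by simp
    have "e \<noteq> f \<longrightarrow> (path_image (\<delta> e) - q ` e) \<inter> path_image (\<delta> f) = {}" using e
    proof (rule cases)
      show "{x, v} \<noteq> f \<longrightarrow> (path_image (\<delta> {x, v}) - q ` {x, v}) \<inter> path_image (\<delta> f) = {}" using f
        by (rule cases) (use \<open>A \<inter> B = {m}\<close> xv J q in auto)
      show "{x, w} \<noteq> f \<longrightarrow> (path_image (\<delta> {x, w}) - q ` {x, w}) \<inter> path_image (\<delta> f) = {}" using f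
        by (rule cases) (use \<open>A \<inter> B = {m}\<close> xv J q in auto)
      fix e assume e: "e \<in> E" "e \<noteq> {v, w}"
      show "e \<noteq> f \<longrightarrow> (path_image (\<delta> e) - q ` e) \<inter> path_image (\<delta> f) = {}" using f
        by (rule cases) (use e vx[OF e] ee[OF e(1)] J qe in simp_all)
    qed
    then show "(path_image (\<delta> e) - q ` e) \<inter> path_image (\<delta> f) = {}" using ef by simp
  qed
  moreover have "simple_graph ?H" using simple V by (auto simp: simple_graph_def)
  ultimately show ?thesis unfolding planar_graph_def by blast
qed

text \<open>The third edge at \<open>a\<close> leaves the path \<open>v a w\<close> on one side; the new edge runs along the other.\<close>

lemma planar_add_edge_degree3:
  assumes va: "{a, v} \<in> E" and aw: "{a, w} \<in> E" and vw: "v \<noteq> w" "{v, w} \<notin> E"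
    and other: "\<And>e. e \<in> E \<Longrightarrow> a \<in> e \<Longrightarrow> e \<in> {{a, v}, {a, w}, {a, n}}"
  shows "planar_graph (add_edge v w H)"
proof -
  have va': "{v, a} \<in> E" using va by (simp add: insert_commute)
  have ne: "a \<noteq> v" "a \<noteq> w" using edgeD va aw by auto
  have V: "a \<in> V" "v \<in> V" "w \<in> V" using edgeD va aw by auto
  have av: "{a, v} = {v, a}" by auto
  show ?thesis
  proof (cases "{a, n} \<in> E \<and> n \<noteq> v \<and> n \<noteq> w")
    case True
    then have n: "{a, n} \<in> E" "n \<noteq> v" "n \<noteq> w" by auto
    then have d: "{a, n} \<noteq> {v, a}" "{a, n} \<noteq> {a, w}" "{a, n} \<inter> {v, a} = {a}" "{a, n} \<inter> {a, w} = {a}"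
      using ne by (auto simp: doubleton_eq_iff)
    have i: "I {a, n} \<inter> I {v, a} = {p a}" "I {a, n} \<inter> I {a, w} = {p a}"
      by (simp_all only: edge_Int[OF n(1) va' d(1)] edge_Int[OF n(1) aw d(2)] d image_insert image_empty)
    obtain \<eta> where \<eta>: "arc \<eta>" "pathstart \<eta> = p a" "pathfinish \<eta> = p n" "path_image \<eta> = I {a, n}"
      using edge_arc[OF n(1)] .
    have "a \<noteq> n" using edgeD n by auto
    then have nz: "p v \<notin> I {a, n}" "p w \<notin> I {a, n}" using vertex_in_image[OF n(1)] V ne n by auto
    obtain g where g: "continuous_on (I {a, n}) g" "\<And>z. z \<in> I {a, n} \<Longrightarrow> (z - p v) / (z - p w) = exp (g z)"
    proof (rule continuous_logarithm_on_contractible)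
      show "continuous_on (I {a, n}) (\<lambda>z. (z - p v) / (z - p w))"
        using nz by (intro continuous_intros) auto
      show "contractible (I {a, n})" using contractible_arc_interior(1)[OF \<eta>(1)] \<eta>(4) by simp
    qed (use nz in auto)
    show ?thesis
    proof (rule planar_add_edge_parallel[OF va' aw vw, of "I {a, n}" g])
      show "I {a, n} \<inter> (I {v, a} \<union> I {a, w}) = {p a}" using i by auto
      show "connected (I {a, n} - {p a})" using connected_half_open_edge[OF n(1)] .
      fix e assume "e \<in> E" "a \<in> e" "e \<noteq> {v, a}" "e \<noteq> {a, w}"
      then have "e = {a, n}" using other[of e] av by auto
      then show "I e \<subseteq> I {a, n}" by simp
    qed (use g in simp_all)
  next
    case False
    \<comment> \<open>Without a third edge the set \<open>T\<close> shrinks to the point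
      \<open>p a\<close>, where any value of the logarithm will do.\<close>
    have "(p a - p v) / (p a - p w) \<noteq> 0" using V ne p_eq by simp
    then obtain g where g: "exp g = (p a - p v) / (p a - p w)" using exp_Ln by blast
    show ?thesis
    proof (rule planar_add_edge_parallel[OF va' aw vw, of "{p a}" "\<lambda>_. g"])
      show "{p a} \<inter> (I {v, a} \<union> I {a, w}) = {p a}" using ends_in_image[OF aw] by auto
      fix e assume "e \<in> E" "a \<in> e" "e \<noteq> {v, a}" "e \<noteq> {a, w}"
      moreover from this have "e = {a, n}" using other[of e] av by auto
      ultimately show "I e \<subseteq> {p a}" using False av by auto
    qed (use g in simp_all)
  qed
qed

text \<open>The two further edges at \<open>a\<close> are tied together by \<open>{b, c}\<close>, so
  the whole triangle can serve as \<open>T\<close>. A path from \<open>t\<close> to \<open>d\<close>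
  off the triangle supplies the logarithm on it.\<close>

lemma planar_add_edge_beside_triangle:
  assumes E: "{a, b} \<in> E" "{a, c} \<in> E" "{b, c} \<in> E" and ta: "{t, a} \<in> E" and ad: "{a, d} \<in> E"
    and ne: "t \<notin> {a, b, c}" "d \<notin> {a, b, c}" "t \<noteq> d" and td: "{t, d} \<notin> E"
    and other: "\<And>e. e \<in> E \<Longrightarrow> a \<in> e \<Longrightarrow> e \<in> {{a, b}, {a, c}, {a, d}, {a, t}}"
    and cc: "connected_component (- tri a b c) (p t) (p d)"
  shows "planar_graph (add_edge t d H)"
proof -
  have da: "{d, a} \<in> E" "{a, d} = {d, a}" using ad by (auto simp: insert_commute)
  have abc: "a \<noteq> b" "a \<noteq> c" using edgeD E by auto
  have "closed (tri a b c)" using compact_tri E by (simp add: compact_imp_closed)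
  then have "path_component (- tri a b c) (p t) (p d)"
    using cc open_path_connected_component by (metis open_Compl)
  then obtain r where r: "path r" "path_image r \<subseteq> - tri a b c" "pathstart r = p t" "pathfinish r = p d"
    unfolding path_component_def by blast
  have ri: "path_image r \<inter> tri a b c = {}" using r(2) by blast
  obtain g where g: "continuous_on (tri a b c) g" "\<And>z. z \<in> tri a b c \<Longrightarrow> exp (g z) = (z - p t) / (z - p d)"
    using continuous_log_quotient[OF r(1,3,4) ri] by blast
  have i: "I {t, a} \<inter> tri a b c = {p a}" "I {d, a} \<inter> tri a b c = {p a}"
    using edge_Int_tri[OF E(1) E(3) E(2) ta ne(1)] edge_Int_tri[OF E(1) E(3) E(2) da(1) ne(2)] by auto
  show ?thesis
  proof (rule planar_add_edge_parallel[OF ta ad ne(3) td, of "tri a b c" g])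
    show "tri a b c \<inter> (I {t, a} \<union> I {a, d}) = {p a}" using i da(2) by auto
    have pa: "p a \<notin> I {b, c}" using vertex_in_image[OF E(3)] edgeD(1)[OF E(1)] abc by auto
    have pb: "p b \<in> I {a, b} - {p a}" "p c \<in> I {a, c} - {p a}" "p b \<in> I {b, c}" "p c \<in> I {b, c}"
      using ends_in_image E edgeD[OF E(1)] edgeD[OF E(2)] p_eq by auto
    have c1: "connected ((I {a, b} - {p a}) \<union> I {b, c})"
      using pb by (intro connected_Un connected_half_open_edge connected_edge E) auto
    have "connected (((I {a, b} - {p a}) \<union> I {b, c}) \<union> (I {a, c} - {p a}))"
      using pb by (intro connected_Un[OF c1] connected_half_open_edge E) auto
    also have "((I {a, b} - {p a}) \<union> I {b, c}) \<union> (I {a, c} - {p a}) = tri a b c - {p a}"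
      using pa by (auto simp: tri_def)
    finally show "connected (tri a b c - {p a})" .
    fix e assume "e \<in> E" "a \<in> e" "e \<noteq> {t, a}" "e \<noteq> {a, d}"
    then have "e = {a, b} \<or> e = {a, c}" using other[of e] by (auto simp: insert_commute)
    then show "I e \<subseteq> tri a b c" by (auto simp: tri_def)
  qed (use g in simp_all)
qed

text \<open>If \<open>t\<close> and \<open>d\<close> lie on the same side of \<open>a b c\<close>,
  the edge \<open>{t, d}\<close> can run beside this triangle. Otherwise \<open>same_side\<close>
  puts \<open>t\<close> and \<open>c\<close> on the same side of \<open>a b d\<close>, and
  \<open>{t, c}\<close> can be added.\<close>

lemma planar_add_edge_beside_K4:
  assumes E: "{a, b} \<in> E" "{a, c} \<in> E" "{a, d} \<in> E" "{a, t} \<in> E" "{b, c} \<in> E" "{b, d} \<in> E"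
    and ne: "t \<notin> {b, c, d}" "c \<noteq> d" and td: "{t, c} \<notin> E" "{t, d} \<notin> E"
    and other: "\<And>e. e \<in> E \<Longrightarrow> a \<in> e \<Longrightarrow> e \<in> {{a, b}, {a, c}, {a, d}, {a, t}}"
  shows "planar_graph (add_edge t c H) \<or> planar_graph (add_edge t d H)"
proof -
  have ta: "{t, a} \<in> E" using E(4) by (simp add: insert_commute)
  have ne': "t \<notin> {a, b, c}" "t \<notin> {a, b, d}" "d \<notin> {a, b, c}" "c \<notin> {a, b, d}" "t \<noteq> c" "t \<noteq> d" "t \<notin> {a, b, c, d}"
    using ne edgeD(3)[OF E(1)] edgeD(3)[OF E(2)] edgeD(3)[OF E(3)] edgeD(3)[OF E(4)] edgeD(3)[OF E(5)] edgeD(3)[OF E(6)] by auto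
  show ?thesis
  proof (cases "connected_component (- tri a b c) (p d) (p t)")
    case True
    then have "connected_component (- tri a b c) (p t) (p d)" by (simp add: connected_component_sym)
    then have "planar_graph (add_edge t d H)"
      by (intro planar_add_edge_beside_triangle[OF E(1) E(2) E(5) ta E(3) ne'(1) ne'(3) ne'(6) td(2) other])
    then show ?thesis ..
  next
    case False
    then have "connected_component (- tri a b d) (p t) (p c)"
      by (rule same_side[OF E(1) E(2) E(5) E(3) E(6) edgeD(1)[OF ta] ne'(7) ne(2)])
    then have "planar_graph (add_edge t c H)"
      by (intro planar_add_edge_beside_triangle[OF E(1) E(3) E(6) ta E(2) ne'(2) ne'(4) ne'(5) td(1)])
        (use other in auto)
    then show ?thesis ..
  qed
qed

end

text \<open>Subdividing \<open>{v, w}\<close> by \<open>x\<close> destroys that edge, but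
  \<open>x\<close> then has degree 2, so the edge can be restored parallel to the path
  \<open>v x w\<close>.\<close>

lemma planar_add_vertex:
  assumes "planar_graph \<lparr>uverts = V, uedges = E\<rparr>" "{v, w} \<in> E" "x \<notin> V"
  shows "planar_graph \<lparr>uverts = insert x V, uedges = insert {x, v} (insert {x, w} E)\<rparr>"
proof -
  let ?H = "\<lparr>uverts = V, uedges = E\<rparr>"
  let ?K = "\<lparr>uverts = insert x V, uedges = insert {x, v} (insert {x, w} (E - {{v, w}}))\<rparr>"
  obtain p \<gamma> where "drawing ?H p \<gamma>" using planar_graphE[OF assms(1)] .
  then interpret H: drawing ?H p \<gamma> .
  have V: "v \<in> V" "w \<in> V" "v \<noteq> w" using H.edgeD[of v w] assms by auto
  have K: "planar_graph ?K" using H.planar_subdivide[of v w x] assms by simp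
  obtain p' \<gamma>' where "drawing ?K p' \<gamma>'" using planar_graphE[OF K] .
  then interpret K: drawing ?K p' \<gamma>' .
  have x: "e \<in> E \<Longrightarrow> x \<notin> e" for e using H.edge_subset[of e] assms(3) by auto
  have "planar_graph (add_edge v w ?K)"
    \<comment> \<open>The value \<open>n = v\<close> fills the slot of a third neighbour, which
      \<open>x\<close> does not have.\<close>
    by (rule K.planar_add_edge_degree3[where a = x and n = v]) (use V assms x in \<open>auto simp: doubleton_eq_iff\<close>)
  moreover have "add_edge v w ?K = \<lparr>uverts = insert x V, uedges = insert {x, v} (insert {x, w} E)\<rparr>"
    using assms(2) by (auto simp: add_edge_def)
  ultimately show ?thesis by simp
qed

text \<open>The points of \<open>p\<close> may fill the plane and leave no room for an arc. Applying
  \<open>exp\<close> to the real parts moves the other vertices into the right half-plane and frees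
  the left one for the edge.\<close>

lemma planar_single_edge:
  fixes p :: "'a \<Rightarrow> complex"
  assumes p: "inj_on p V" and xy: "x \<in> V" "y \<in> V" "x \<noteq> y"
  shows "planar_graph \<lparr>uverts = V, uedges = {{x, y}}\<rparr>"
proof -
  define q where "q z = (if z = x then -1 else if z = y then -2 else Complex (exp (Re (p z))) (Im (p z)))" for z
  have ne: "Complex (exp r) s \<noteq> -1" "Complex (exp r) s \<noteq> -2" for r s
    by (auto simp: complex_eq_iff) (metis exp_gt_zero less_asym neg_less_0_iff_less zero_less_numeral zero_less_one)+
  have seg: "Complex (exp r) s \<notin> closed_segment (-1) (-2)" for r s
  proof
    assume "Complex (exp r) s \<in> closed_segment (-1) (-2)"
    then obtain u where u: "0 \<le> u" "u \<le> 1" "Complex (exp r) s = (1 - u) *\<^sub>R (-1) + u *\<^sub>R (-2)"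
      by (auto simp: in_segment)
    from arg_cong[OF u(3), of Re] have "exp r = - 1 - u" by simp
    then show False using u(1) exp_gt_zero[of r] by linarith
  qed
  have inj: "inj_on q V"
  proof (rule inj_onI)
    fix a b assume ab: "a \<in> V" "b \<in> V" "q a = q b"
    show "a = b"
    proof (cases "a \<in> {x, y} \<or> b \<in> {x, y}")
      case True
      then show ?thesis using ab(3) ne ne[symmetric] by (auto simp: q_def split: if_splits)
    next
      case False
      then have "p a = p b" using ab(3) by (simp add: q_def complex_eq_iff)
      then show ?thesis using p ab by (auto dest: inj_onD)
    qed
  qed
  have "plane_drawing \<lparr>uverts = V, uedges = {{x, y}}\<rparr> q (\<lambda>_. linepath (-1) (-2))"
    unfolding plane_drawing_def
  proof (intro conjI ballI impI)
    fix e assume "e \<in> uedges \<lparr>uverts = V, uedges = {{x, y}}\<rparr>"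
    then have e: "e = {x, y}" by simp
    have qe: "q ` e = {-1, -2}" using xy by (auto simp: e q_def)
    show "{pathstart (linepath (-1) (-2)), pathfinish (linepath (-1) (-2))} = q ` e" using qe by simp
    show "(path_image (linepath (-1) (-2)) - q ` e) \<inter> q ` uverts \<lparr>uverts = V, uedges = {{x, y}}\<rparr> = {}"
      unfolding qe using seg by (auto simp: q_def split: if_splits)
  qed (use inj in auto)
  then show ?thesis using xy by (auto simp: planar_graph_def simple_graph_def)
qed

section \<open>Inserting complete graphs on at most four vertices\<close>

definition pairs :: "'a set \<Rightarrow> 'a set set" where
  "pairs S = {{x, y} | x y. x \<in> S \<and> y \<in> S \<and> x \<noteq> y}"

lemma pairs_empty [simp]: "pairs {} = {}"
  by (simp add: pairs_def)

lemma pairs_insert [simp]: "pairs (insert x S) = (\<lambda>y. {x, y}) ` (S - {x}) \<union> pairs S"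
  unfolding pairs_def by (auto simp: image_def)

text \<open>\<open>y\<close> is a leaf at \<open>x\<close>. Adding \<open>z\<close> beside
  \<open>{x, y}\<close> and \<open>u\<close> beside \<open>{y, z}\<close> gives \<open>y\<close>
  degree 3, so the one missing edge \<open>{x, u}\<close> can be drawn along the path
  \<open>x y u\<close>.\<close>

lemma planar_extend_to_K4:
  assumes H: "planar_graph \<lparr>uverts = V, uedges = E\<rparr>" and xy: "{x, y} \<in> E"
    and y: "\<And>e. e \<in> E \<Longrightarrow> y \<in> e \<Longrightarrow> e = {x, y}" and zu: "z \<notin> V" "u \<notin> V" "z \<noteq> u"
  shows "planar_graph \<lparr>uverts = insert u (insert z V), uedges = E \<union> pairs {x, y, z, u}\<rparr>"
proof -
  let ?E1 = "insert {z, x} (insert {z, y} E)"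
  let ?E2 = "insert {u, z} (insert {u, y} ?E1)"
  have sub: "e \<subseteq> V" if "e \<in> E" for e
    using H that by (auto simp: planar_graph_def simple_graph_def)
  have V: "x \<in> V" "y \<in> V" using sub[OF xy] by auto
  have xny: "x \<noteq> y" using H xy by (auto simp: planar_graph_def simple_graph_def)
  have "planar_graph \<lparr>uverts = insert z V, uedges = ?E1\<rparr>"
    by (rule planar_add_vertex[OF H xy zu(1)])
  then have H2: "planar_graph \<lparr>uverts = insert u (insert z V), uedges = ?E2\<rparr>"
    by (rule planar_add_vertex) (use zu in auto)
  obtain p \<gamma> where "drawing \<lparr>uverts = insert u (insert z V), uedges = ?E2\<rparr> p \<gamma>"
    using planar_graphE[OF H2] .
  then interpret drawing "\<lparr>uverts = insert u (insert z V), uedges = ?E2\<rparr>" p \<gamma> .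
  have "planar_graph (add_edge x u \<lparr>uverts = insert u (insert z V), uedges = ?E2\<rparr>)"
  proof (rule planar_add_edge_degree3[where a = y and n = z])
    show "{x, u} \<notin> uedges \<lparr>uverts = insert u (insert z V), uedges = ?E2\<rparr>"
      using zu V xny sub[of "{x, u}"] by (auto simp: doubleton_eq_iff)
    fix e assume "e \<in> uedges \<lparr>uverts = insert u (insert z V), uedges = ?E2\<rparr>" "y \<in> e"
    then show "e \<in> {{y, x}, {y, u}, {y, z}}" using y[of e] zu V xny by auto
  qed (use xy zu V in \<open>auto simp: insert_commute\<close>)
  then show ?thesis
    by (rule planar_subgraph) (use xy V sub in \<open>auto simp: add_edge_def insert_commute\<close>)
qed

lemma finite_card_le_3:
  assumes "finite S" "card S \<le> 3"
  obtains "S = {}" | a where "S = {a}" | a b where "S = {a, b}" "a \<noteq> b"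
    | a b c where "S = {a, b, c}" "a \<noteq> b" "a \<noteq> c" "b \<noteq> c"
proof -
  have "card S = 0 \<or> card S = 1 \<or> card S = 2 \<or> card S = 3" using assms(2) by linarith
  then show ?thesis
    using assms(1) that by (metis card_0_eq card_1_singletonE card_2_iff card_3_iff)
qed

text \<open>In a crowded drawing new vertices find room only beside an existing edge, hence
  \<open>{v, w}\<close>. The link \<open>{v, x}\<close> is the additional edge that will contradict
  maximality.\<close>

lemma planar_attach_clique:
  assumes H: "planar_graph \<lparr>uverts = V, uedges = E\<rparr>" and vw: "{v, w} \<in> E"
    and S: "finite S" "card S \<le> 4" "S \<inter> V = {}" "x \<in> S"
  shows "planar_graph \<lparr>uverts = V \<union> S, uedges = insert {v, x} (E \<union> pairs S)\<rparr>"
proof -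
  have sub: "e \<subseteq> V" if "e \<in> E" for e
    using H that by (auto simp: planar_graph_def simple_graph_def)
  have V: "v \<in> V" "x \<notin> V" using sub[OF vw] S by auto
  have "planar_graph \<lparr>uverts = insert x V, uedges = insert {x, v} (insert {x, w} E)\<rparr>"
    using planar_add_vertex[OF H vw V(2)] .
  then have H1: "planar_graph \<lparr>uverts = insert x V, uedges = insert {x, v} E\<rparr>"
    by (rule planar_subgraph) (use sub V in auto)
  have xe: "x \<notin> e" if "e \<in> E" for e using sub[OF that] V by auto
  define Y where "Y = S - {x}"
  have SY: "S = insert x Y" and Y: "finite Y" "card Y \<le> 3" "Y \<inter> insert x V = {}"
    using S by (auto simp: Y_def)
  \<comment> \<open>A vertex inserted beside \<open>{x, v}\<close> becomes a leaf at
    \<open>x\<close> once its edge to \<open>v\<close> is dropped, as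
    \<open>planar_extend_to_K4\<close> requires.\<close>
  have extend: "planar_graph \<lparr>uverts = insert y (insert x V), uedges = insert {x, y} (insert {x, v} E)\<rparr>"
    if y: "y \<notin> insert x V" for y
  proof -
    have "planar_graph \<lparr>uverts = insert y (insert x V), uedges = insert {y, x} (insert {y, v} (insert {x, v} E))\<rparr>"
      by (rule planar_add_vertex[OF H1]) (use y in auto)
    then show ?thesis by (rule planar_subgraph) (use sub V in \<open>auto simp: insert_commute\<close>)
  qed
  from Y(1,2) show ?thesis
  proof (cases rule: finite_card_le_3)
    case 1
    then show ?thesis using H1 SY by (simp add: insert_commute)
  next
    case (2 a)
    then have "a \<notin> insert x V" using Y(3) by auto
    from extend[OF this] show ?thesis
      by (rule planar_subgraph) (use 2 SY sub V in \<open>auto simp: insert_commute\<close>)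
  next
    case (3 a b)
    then have n: "a \<notin> insert x V" "b \<notin> insert a (insert x V)" using Y(3) by auto
    have "planar_graph \<lparr>uverts = insert b (insert a (insert x V)),
        uedges = insert {b, x} (insert {b, a} (insert {x, a} (insert {x, v} E)))\<rparr>"
      by (rule planar_add_vertex[OF extend[OF n(1)]]) (use n in auto)
    then show ?thesis
      by (rule planar_subgraph) (use 3 SY sub V in \<open>auto simp: insert_commute\<close>)
  next
    case (4 a b c)
    then have n: "a \<notin> insert x V" "b \<notin> insert a (insert x V)" "c \<notin> insert a (insert x V)" using Y(3) by auto
    have "planar_graph \<lparr>uverts = insert c (insert b (insert a (insert x V))),
        uedges = insert {x, a} (insert {x, v} E) \<union> pairs {x, a, b, c}\<rparr>"
    proof (rule planar_extend_to_K4[OF extend[OF n(1)]])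
      fix e assume "e \<in> insert {x, a} (insert {x, v} E)" "a \<in> e"
      then show "e = {x, a}" using sub[of e] n(1) V by auto
    qed (use n 4 in auto)
    then show ?thesis
      by (rule planar_subgraph) (use 4 SY sub V in \<open>auto simp: insert_commute\<close>)
  qed
qed

text \<open>The insertions are those used for attaching a clique, now starting from a single
  edge.\<close>

lemma planar_complete:
  assumes "finite S" "card S \<le> 4"
  shows "planar_graph \<lparr>uverts = S, uedges = pairs S\<rparr>"
proof (cases "S = {}")
  case True
  then show ?thesis by (simp add: planar_graph_def simple_graph_def plane_drawing_def)
next
  case False
  then obtain x where x: "x \<in> S" by blast
  define Y where "Y = S - {x}"
  have SY: "S = insert x Y" and Y: "finite Y" "card Y \<le> 3" "x \<notin> Y"
    using assms x by (auto simp: Y_def)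
  have edge: "planar_graph \<lparr>uverts = {x, y}, uedges = {{x, y}}\<rparr>" if "x \<noteq> y" for y
    by (rule planar_single_edge[of "\<lambda>z. if z = x then 0 else 1"]) (use that in \<open>auto simp: inj_on_def\<close>)
  from Y(1,2) show ?thesis
  proof (cases rule: finite_card_le_3)
    case 1
    then show ?thesis using SY by (simp add: planar_graph_def simple_graph_def plane_drawing_def)
  next
    case (2 a)
    then show ?thesis using edge[of a] Y SY by simp
  next
    case (3 a b)
    have "planar_graph \<lparr>uverts = insert b {x, a}, uedges = insert {b, x} (insert {b, a} {{x, a}})\<rparr>"
      by (rule planar_add_vertex[OF edge]) (use 3 Y in auto)
    then show ?thesis
      by (rule planar_subgraph) (use 3 Y SY in \<open>auto simp: insert_commute\<close>)
  next
    case (4 a b c)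
    have "planar_graph \<lparr>uverts = insert c (insert b {x, a}), uedges = {{x, a}} \<union> pairs {x, a, b, c}\<rparr>"
      by (rule planar_extend_to_K4[OF edge]) (use 4 Y in auto)
    then show ?thesis
      by (rule planar_subgraph) (use 4 Y SY in \<open>auto simp: insert_commute\<close>)
  qed
qed

section \<open>Power graphs\<close>

lemma coprime_of_combination:
  fixes k n c :: nat
  assumes "coprime k c" "n + c = a * k \<or> n = a * k + c"
  shows "coprime k n"
proof (rule coprimeI)
  fix d assume d: "d dvd k" "d dvd n"
  have "d dvd c" using assms(2)
  proof
    assume "n + c = a * k"
    then have "d dvd n + c" using d(1) by simp
    then show ?thesis using d(2) by (simp add: dvd_add_right_iff)
  next
    assume "n = a * k + c"
    then have "d dvd a * k + c" using d(2) by simp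
    then show ?thesis using d(1) by (simp add: dvd_add_right_iff)
  qed
  then show "d dvd 1" using assms(1) d(1) coprime_common_divisor by blast
qed

text \<open>As exponents in a cyclic group of order \<open>n\<close> these give a complete graph on
  five vertices: four of the powers are generators, and a generator is adjacent to every other
  nontrivial element.\<close>

lemma four_coprime_and_another:
  fixes n :: nat
  assumes "7 \<le> n"
  obtains i j k l m where "distinct [i, j, k, l, m]" "\<forall>r\<in>{i, j, k, l}. coprime r n" "\<forall>r\<in>{i, j, k, l, m}. 0 < r \<and> r < n"
proof (cases "odd n")
  case True
  have "coprime (n - 1) n" by (rule coprime_of_combination[of _ 1 _ 1]) (use assms in auto)
  moreover have "coprime (n - 2) n"
    by (rule coprime_of_combination[of _ 2 _ 1]) (use assms True in auto)
  moreover have "coprime 2 n" using True by simp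
  moreover have "distinct [1, 2, n - 1, n - 2, 4]" using assms by (simp, presburger)
  ultimately show ?thesis using assms by (intro that[of 1 2 "n - 1" "n - 2" 4]) auto
next
  case False
  have c1: "coprime (n - 1) n" by (rule coprime_of_combination[of _ 1 _ 1]) (use assms in auto)
  show ?thesis
  proof (cases "4 dvd n")
    case True
    then obtain q where q: "n = 4 * q" by blast
    have "coprime (2 * q - 1) n"
      by (rule coprime_of_combination[of _ 2 _ 2]) (use q assms in auto)
    moreover have "coprime (2 * q + 1) n"
      by (rule coprime_of_combination[of _ 2 _ 2]) (use q assms in auto)
    moreover have "distinct [1, 2 * q - 1, 2 * q + 1, n - 1, 2]" using q assms by (simp, presburger)
    ultimately show ?thesis using c1 q assms by (intro that[of 1 "2 * q - 1" "2 * q + 1" "n - 1" 2]) auto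
  next
    case nd: False
    obtain r where r: "n = 2 * r" using False by blast
    have "odd r" using nd r by (metis dvd_mult_cancel1 dvdE mult.assoc dvd_triv_left numeral_Bit0_eq_double)
    then obtain q where "r = 2 * q + 1" using oddE by blast
    \<comment> \<open>By \<open>7 \<le> n\<close> the number \<open>q\<close> is at least 2. For
      \<open>q = 1\<close> the residue \<open>2 * q - 1\<close> would be 1 and
      \<open>2 * q + 3\<close> would be \<open>n - 1\<close>.\<close>
    then have q: "n = 4 * q + 2" using r by simp
    have c4: "coprime s 4" if "odd s" for s :: nat
    proof -
      have "coprime s (2 ^ 2)" using that by (subst coprime_power_right_iff) simp
      then show ?thesis by simp
    qed
    have "coprime (2 * q - 1) n"
      by (rule coprime_of_combination[of _ 4 _ 2], rule c4) (use q assms in auto)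
    moreover have "coprime (2 * q + 3) n"
      by (rule coprime_of_combination[of _ 4 _ 2], rule c4) (use q assms in auto)
    moreover have "distinct [1, 2 * q - 1, 2 * q + 3, n - 1, 2]" using q assms by (simp, presburger)
    ultimately show ?thesis using c1 q assms by (intro that[of 1 "2 * q - 1" "2 * q + 3" "n - 1" 2]) auto
  qed
qed

section \<open>Cyclic subgroups and element orders\<close>

context group
begin

abbreviation "cyc x \<equiv> generate G {x}"

lemma pow_in_cyc: "x \<in> carrier G \<Longrightarrow> x [^] (k::nat) \<in> cyc x"
  using generate_pow[of x] by (auto simp flip: int_pow_int)

lemma cyc_subset: "x \<in> carrier G \<Longrightarrow> y \<in> cyc x \<Longrightarrow> cyc y \<subseteq> cyc x"
  using generate_subgroup_incl[of "{y}" "cyc x"] generate_is_subgroup[of "{x}"] by auto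

lemma cyc_carrier: "x \<in> carrier G \<Longrightarrow> y \<in> cyc x \<Longrightarrow> y \<in> carrier G"
  using generate_incl[of "{x}"] by auto

lemma cyc_self: "x \<in> cyc x"
  by (rule generate.incl) simp

lemma cyc_eq_pow:
  assumes x: "x \<in> carrier G" "ord x \<noteq> 0" and y: "y \<in> cyc x"
  obtains k where "k < ord x" "y = x [^] k"
proof -
  have "y \<in> {x [^] k | k. k \<in> {0 .. ord x - 1}}"
    using y unfolding generate_pow_nat[OF x] ord_elems_inf_carrier[OF x] .
  then obtain k where "k \<in> {0 .. ord x - 1}" "y = x [^] k" by blast
  then show ?thesis using that[of k] x(2) by (auto intro: that)
qed

lemma ord_dvd_of_cyc:
  assumes x: "x \<in> carrier G" "ord x \<noteq> 0" and y: "y \<in> cyc x"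
  shows "ord y dvd ord x"
proof -
  obtain k where "k < ord x" "y = x [^] k" by (rule cyc_eq_pow[OF assms])
  then have "y [^] ord x = (x [^] ord x) [^] k" using x by (metis nat_pow_pow mult.commute \<open>y = x [^] k\<close>)
  then have "y [^] ord x = \<one>" using x by simp
  then show ?thesis using pow_eq_id cyc_carrier[OF x(1) y] by blast
qed

lemma cyc_eq_if_ord_eq:
  assumes x: "x \<in> carrier G" "ord x \<noteq> 0" and y: "y \<in> cyc x" "ord y = ord x"
  shows "cyc y = cyc x"
proof (rule card_subset_eq)
  show "finite (cyc x)" using generate_pow_card[OF x(1)] x(2) by (metis card.infinite)
  show "cyc y \<subseteq> cyc x" using cyc_subset x y by blast
  show "card (cyc y) = card (cyc x)" using generate_pow_card[OF x(1)] generate_pow_card[OF cyc_carrier[OF x(1) y(1)]] y(2) by simp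
qed

lemma cyc_coprime_pow:
  assumes x: "x \<in> carrier G" "ord x \<noteq> 0" and k: "coprime k (ord x)" "k \<noteq> 0"
  shows "cyc (x [^] k) = cyc x"
proof (rule cyc_eq_if_ord_eq[OF x pow_in_cyc[OF x(1)]])
  have "gcd (ord x) k = 1" using k by (simp add: coprime_commute)
  then show "ord (x [^] k) = ord x" using ord_pow_gen[OF x(1), of k] k by simp
qed

lemma pow_eq_iff:
  assumes "x \<in> carrier G" "i < ord x" "j < ord x"
  shows "x [^] i = x [^] j \<longleftrightarrow> i = j"
  using ord_inj[OF assms(1)] assms(2,3) by (auto dest: inj_onD)

text \<open>Below order 6, a nontrivial element of a cyclic group fails to be a generator only
  if it is the involution of a cyclic group of order 4.\<close>
lemma cyc_cases:
  assumes x: "x \<in> carrier G" "ord x \<in> {2, 3, 4, 5}" and y: "y \<in> cyc x" "y \<noteq> \<one>"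
  shows "cyc y = cyc x \<or> ord x = 4 \<and> y = x [^] (2::nat)"
proof -
  have n0: "ord x \<noteq> 0" using x(2) by auto
  obtain k where k: "k < ord x" "y = x [^] k" using cyc_eq_pow[OF x(1) n0 y(1)] .
  have "k \<noteq> 0" using k y(2) by (metis nat_pow_0)
  have c: "coprime 3 (4::nat)" "coprime 2 (3::nat)" "coprime 2 (5::nat)" "coprime 3 (5::nat)" "coprime 4 (5::nat)"
    by (simp_all add: coprime_iff_gcd_eq_1 gcd_non_0_nat)
  have "coprime k (ord x) \<or> ord x = 4 \<and> k = 2"
    using x(2) k(1) \<open>k \<noteq> 0\<close> c by (auto simp: less_Suc_eq numeral_eq_Suc)
  then show ?thesis using cyc_coprime_pow[OF x(1) n0 _ \<open>k \<noteq> 0\<close>] k(2) by auto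
qed

section \<open>Consequences of planarity for the power graph\<close>

abbreviation "PG \<equiv> proper_power_graph G"
abbreviation "PV \<equiv> carrier G - {\<one>}"
abbreviation "PE \<equiv> uedges PG"

lemma PG_verts [simp]: "uverts PG = PV"
  by (simp add: proper_power_graph_def)

lemma PG_eq: "PG = \<lparr>uverts = PV, uedges = PE\<rparr>"
  by (simp add: proper_power_graph_def)

lemma add_edge_PG: "add_edge x y PG = \<lparr>uverts = PV, uedges = insert {x, y} PE\<rparr>"
  by (simp add: add_edge_def proper_power_graph_def)

lemma PE_iff: "{x, y} \<in> PE \<longleftrightarrow> x \<in> PV \<and> y \<in> PV \<and> x \<noteq> y \<and> (x \<in> cyc y \<or> y \<in> cyc x)"
  by (auto simp: proper_power_graph_def doubleton_eq_iff)

lemma PE_E: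
  assumes "e \<in> PE" "x \<in> e"
  obtains y where "e = {x, y}" "{x, y} \<in> PE"
proof -
  obtain a b where "e = {a, b}" "{a, b} \<in> PE" using assms(1) by (auto simp: proper_power_graph_def)
  then show ?thesis using that[of a] that[of b] assms(2) by (auto simp: insert_commute)
qed

lemma PE_subset: "e \<in> PE \<Longrightarrow> e \<subseteq> PV"
  by (auto simp: proper_power_graph_def)

text \<open>Otherwise there are five pairwise adjacent powers: for infinite order those with
  exponents 1, 2, 4, 8, 16, each dividing the next; for finite order above 6 those of
  \<open>four_coprime_and_another\<close>.\<close>

lemma ord_le_6_if_planar:
  assumes "planar_graph PG" and x: "x \<in> carrier G"
  shows "ord x \<noteq> 0" "ord x \<le> 6"
proof -
  obtain p \<gamma> where "drawing PG p \<gamma>" using planar_graphE[OF assms(1)] .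
  then interpret D: drawing PG p \<gamma> .
  show n0: "ord x \<noteq> 0"
  proof
    assume 0: "ord x = 0"
    have inj: "x [^] i = x [^] j \<longleftrightarrow> i = j" for i j :: nat
      using int_pow_eq[OF x, of "int i" "int j"] 0 by (auto simp: int_pow_int)
    have one: "x [^] i \<noteq> \<one>" if "i \<noteq> 0" for i :: nat
      using inj[of i 0] that by simp
    have *: "{x [^] i, x [^] j} \<in> PE" if "i \<noteq> 0" "j \<noteq> 0" "i \<noteq> j" "i dvd j" for i j :: nat
    proof -
      from that(4) obtain q where "j = i * q" by blast
      then have "x [^] j = (x [^] i) [^] q" using x by (simp add: nat_pow_pow)
      then have "x [^] j \<in> cyc (x [^] i)" using pow_in_cyc[of "x [^] i" q] x by simp
      then show ?thesis using that one inj x by (auto simp: PE_iff)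
    qed
    show False
      by (rule D.no_K5[of "x [^] (1::nat)" "x [^] (2::nat)" "x [^] (4::nat)" "x [^] (8::nat)" "x [^] (16::nat)"]; rule *)
        auto
  qed
  show "ord x \<le> 6"
  proof (rule ccontr)
    assume "\<not> ord x \<le> 6"
    then have "7 \<le> ord x" by simp
    then obtain i j k l m where d: "distinct [i, j, k, l, m]" and c: "\<forall>r\<in>{i, j, k, l}. coprime r (ord x)"
      and r: "\<forall>r\<in>{i, j, k, l, m}. 0 < r \<and> r < ord x"
      by (rule four_coprime_and_another)
    have *: "{x [^] a, x [^] b} \<in> PE" if "a \<in> {i, j, k, l}" "b \<in> {i, j, k, l, m}" "a \<noteq> b" for a b
    proof -
      have ab: "0 < a" "a < ord x" "0 < b" "b < ord x" using that r by auto
      have "x [^] a \<noteq> \<one>" "x [^] b \<noteq> \<one>" "x [^] a \<noteq> x [^] b"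
        using pow_eq_iff[OF x ab(2), of 0] pow_eq_iff[OF x ab(4), of 0] pow_eq_iff[OF x ab(2,4)] ab that(3) n0 by auto
      moreover have "cyc (x [^] a) = cyc x" using cyc_coprime_pow[OF x n0] c that(1) ab(1) by auto
      ultimately show ?thesis using pow_in_cyc[OF x, of b] x by (auto simp: PE_iff)
    qed
    show False
      by (rule D.no_K5[of "x [^] i" "x [^] j" "x [^] k" "x [^] l" "x [^] m"]; rule *) (use d in auto)
  qed
qed

text \<open>If \<open>x\<close> generated a proper subgroup of \<open>cyc y\<close>, then
  \<open>ord y\<close> would be a proper multiple of \<open>ord x\<close>, hence at least 8, against
  the bound 6.\<close>

lemma PE_in_cyc_if_ord_ge_4:
  assumes "planar_graph PG" "{x, y} \<in> PE" "4 \<le> ord x"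
  shows "y \<in> cyc x"
proof -
  have xy: "x \<in> carrier G" "y \<in> carrier G" "x \<in> cyc y \<or> y \<in> cyc x" using assms(2) by (auto simp: PE_iff)
  note o = ord_le_6_if_planar[OF assms(1) xy(2)]
  show ?thesis using xy(3)
  proof
    assume x: "x \<in> cyc y"
    then obtain q where q: "ord y = ord x * q" using ord_dvd_of_cyc[OF xy(2) o(1)] by blast
    have "q = 1"
    proof (rule ccontr)
      assume "q \<noteq> 1"
      then have "2 \<le> q" using q o(1) by (cases q) auto
      then have "4 * 2 \<le> ord x * q" using assms(3) by (intro mult_le_mono)
      then show False using q o(2) by simp
    qed
    then have "cyc x = cyc y" using cyc_eq_if_ord_eq[OF xy(2) o(1) x] q by simp
    then show ?thesis using cyc_self by simp
  qed
qed

text \<open>The generators \<open>f 1\<close> and \<open>f 5\<close> are adjacent to all other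
  nontrivial powers, while \<open>f 3\<close> has order 2 and \<open>f 2\<close>, \<open>f 4\<close>
  have order 3. As the neighbours of \<open>f 1\<close> all lie in \<open>cyc x\<close>,
  \<open>planar_add_edge_beside_K4\<close> applies with \<open>a = f 1\<close>,
  \<open>b = f 5\<close>, \<open>c = f 2\<close>, \<open>d = f 4\<close>,
  \<open>t = f 3\<close>.\<close>

lemma planar_add_edge_order_6:
  assumes P: "planar_graph PG" and x: "x \<in> carrier G" "ord x = 6"
  shows "\<exists>y\<in>PV. \<exists>z\<in>PV. y \<noteq> z \<and> {y, z} \<notin> PE \<and> planar_graph (add_edge y z PG)"
proof -
  obtain p \<gamma> where "drawing PG p \<gamma>" using planar_graphE[OF P] .
  then interpret D: drawing PG p \<gamma> .
  define f where "f k = x [^] (k::nat)" for k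
  have fx: "f 1 = x" using x by (simp add: f_def)
  have eq: "f i = f j \<longleftrightarrow> i = j" if "i < 6" "j < 6" for i j
    using pow_eq_iff[OF x(1), of i j] that x(2) by (simp add: f_def)
  have V: "f i \<in> PV" if "0 < i" "i < 6" for i
    using eq[of i 0] that x by (auto simp: f_def)
  have cy: "cyc (f 1) = cyc x" "cyc (f 5) = cyc x"
    using cyc_coprime_pow[OF x(1), of 1] cyc_coprime_pow[OF x(1), of 5] x(2)
    by (auto simp: f_def coprime_iff_gcd_eq_1 gcd_non_0_nat)
  have e: "{f i, f j} \<in> PE" if "i \<in> {1, 5}" "j \<in> {1..5}" "i \<noteq> j" for i j
    using that V[of i] V[of j] eq[of i j] cy pow_in_cyc[OF x(1), of j] by (auto simp: PE_iff f_def)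
  have o: "ord (f 2) = 3" "ord (f 4) = 3" "ord (f 3) = 2"
    using ord_pow_gen[OF x(1)] x(2) by (simp_all add: f_def gcd_non_0_nat)
  have nd: "\<not> (3::nat) dvd 2" "\<not> (2::nat) dvd 3" by presburger+
  have ne: "{f 3, f j} \<notin> PE" if "j \<in> {2, 4}" for j
  proof
    assume "{f 3, f j} \<in> PE"
    then have "f 3 \<in> cyc (f j) \<or> f j \<in> cyc (f 3)" by (simp add: PE_iff)
    moreover have "f 3 \<in> carrier G" "f j \<in> carrier G" "ord (f j) = 3" using x that o by (auto simp: f_def)
    ultimately show False using ord_dvd_of_cyc[of "f 3" "f j"] ord_dvd_of_cyc[of "f j" "f 3"] o nd by auto
  qed
  have "planar_graph (add_edge (f 3) (f 2) PG) \<or> planar_graph (add_edge (f 3) (f 4) PG)"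
  proof (rule D.planar_add_edge_beside_K4[of "f 1" "f 5"])
    fix e' assume "e' \<in> PE" "f 1 \<in> e'"
    then obtain y where y: "e' = {f 1, y}" "{f 1, y} \<in> PE" by (rule PE_E)
    then have "y \<in> cyc x" using PE_in_cyc_if_ord_ge_4[OF P, of "f 1" y] x fx by simp
    then obtain k where k: "k < 6" "y = f k" using cyc_eq_pow[OF x(1), of y] x(2) by (auto simp: f_def)
    moreover have "y \<noteq> \<one>" "y \<noteq> f 1" using y(2) by (auto simp: PE_iff)
    ultimately have "k \<noteq> 0" "k \<noteq> 1" by (metis f_def nat_pow_0, blast)
    then have "k = 2 \<or> k = 3 \<or> k = 4 \<or> k = 5" using k(1) by linarith
    then show "e' \<in> {{f 1, f 5}, {f 1, f 2}, {f 1, f 4}, {f 1, f 3}}" using y(1) k(2) by auto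
  qed (use e ne eq in auto)
  moreover have "f 3 \<in> PV" "f 2 \<in> PV" "f 4 \<in> PV" "f 3 \<noteq> f 2" "f 3 \<noteq> f 4" using V eq by auto
  ultimately show ?thesis using ne[of 2] ne[of 4] by blast
qed

text \<open>Only \<open>t = x [^] 2\<close> joins \<open>x\<close> and its inverse \<open>d\<close>
  to the rest of the graph. Both are deleted; then \<open>x\<close> is put back beside the edge
  \<open>{t, y}\<close> and \<open>d\<close> beside \<open>{x, t}\<close>. This recovers all old
  edges and gains \<open>{x, y}\<close>.\<close>

lemma planar_add_edge_order_4:
  assumes P: "planar_graph PG" and x: "x \<in> carrier G" "ord x = 4"
    and y: "{x [^] (2::nat), y} \<in> PE" "y \<noteq> x" "y \<noteq> x [^] (3::nat)"
  shows "{x, y} \<notin> PE \<and> planar_graph (add_edge x y PG)"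
proof -
  define t d where "t = x [^] (2::nat)" and "d = x [^] (3::nat)"
  have eq: "x [^] i = x [^] j \<longleftrightarrow> i = j" if "i < 4" "j < 4" for i j :: nat
    using pow_eq_iff[OF x(1), of i j] that x(2) by simp
  have ne: "x \<noteq> t" "x \<noteq> d" "t \<noteq> d" "x \<noteq> \<one>" "d \<noteq> \<one>" "t \<noteq> \<one>"
    using eq[of 1 2] eq[of 1 3] eq[of 2 3] eq[of 1 0] eq[of 3 0] eq[of 2 0] x by (auto simp: t_def d_def)
  have V: "x \<in> PV" "d \<in> PV" "t \<in> PV" using ne x by (auto simp: t_def d_def)
  have cy: "cyc d = cyc x" using cyc_coprime_pow[OF x(1), of 3] x(2)
    by (auto simp: d_def coprime_iff_gcd_eq_1 gcd_non_0_nat)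
  have od: "ord d = 4" using generate_pow_card cy x V by (metis DiffD1)
  have elems: "z \<in> {x, t, d}" if "z \<in> cyc x" "z \<noteq> \<one>" for z
  proof -
    have "ord x \<noteq> 0" using x(2) by simp
    from cyc_eq_pow[OF x(1) this that(1)] obtain k :: nat where k: "k < 4" "z = x [^] k"
      unfolding x(2) by blast
    then have "k \<noteq> 0" using that(2) by (metis nat_pow_0)
    then have "k = 1 \<or> k = 2 \<or> k = 3" using k(1) by linarith
    then show ?thesis using k(2) x by (auto simp: t_def d_def)
  qed
  have nb: "z \<in> {x, t, d}" if "{x, z} \<in> PE \<or> {d, z} \<in> PE" for z
    using that PE_in_cyc_if_ord_ge_4[OF P, of x z] PE_in_cyc_if_ord_ge_4[OF P, of d z] x od cy elems
    by (auto simp: PE_iff)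
  have yt: "{t, y} \<in> PE" "y \<noteq> x" "y \<noteq> d" using y by (auto simp: t_def d_def)
  then have ty: "t \<noteq> y" "y \<in> PV" by (auto simp: PE_iff)
  let ?V = "PV - {x, d}" and ?E = "{e \<in> PE. e \<subseteq> PV - {x, d}}"
  have H0: "planar_graph \<lparr>uverts = ?V, uedges = ?E\<rparr>" by (rule planar_subgraph[OF P]) auto
  have H1: "planar_graph \<lparr>uverts = insert x ?V, uedges = insert {x, t} (insert {x, y} ?E)\<rparr>"
    by (rule planar_add_vertex[OF H0]) (use yt ty V ne in auto)
  have H2: "planar_graph \<lparr>uverts = insert d (insert x ?V),
      uedges = insert {d, x} (insert {d, t} (insert {x, t} (insert {x, y} ?E)))\<rparr>"
    by (rule planar_add_vertex[OF H1]) (use ne in auto)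
  have "add_edge x y PG = \<lparr>uverts = PV, uedges = insert {x, y} PE\<rparr>"
    by (rule add_edge_PG)
  moreover have "planar_graph \<lparr>uverts = PV, uedges = insert {x, y} PE\<rparr>"
  proof (rule planar_subgraph[OF H2])
    show "PV \<subseteq> uverts \<lparr>uverts = insert d (insert x ?V), uedges = insert {d, x} (insert {d, t} (insert {x, t} (insert {x, y} ?E)))\<rparr>"
      using V by auto
    have "e \<in> insert {d, x} (insert {d, t} (insert {x, t} ?E))" if e: "e \<in> PE" for e
    proof (cases "x \<in> e")
      case True
      then obtain z where z: "e = {x, z}" "{x, z} \<in> PE" using PE_E[OF e] by blast
      then have "z \<in> {x, t, d}" using nb by blast
      then show ?thesis using z by (auto simp: PE_iff insert_commute)
    next
      case x: False
      show ?thesis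
      proof (cases "d \<in> e")
        case True
        then obtain z where z: "e = {d, z}" "{d, z} \<in> PE" using PE_E[OF e] by blast
        then have "z \<in> {x, t, d}" using nb by blast
        then show ?thesis using z by (auto simp: PE_iff)
      next
        case False
        then have "e \<subseteq> PV - {x, d}" using x PE_subset[OF e] by blast
        then show ?thesis using e by simp
      qed
    qed
    then show "insert {x, y} PE \<subseteq> uedges \<lparr>uverts = insert d (insert x ?V), uedges = insert {d, x} (insert {d, t} (insert {x, t} (insert {x, y} ?E)))\<rparr>"
      by auto
    show "e \<subseteq> PV" if "e \<in> insert {x, y} PE" for e using that PE_subset[of e] V ty by auto
  qed
  ultimately show ?thesis using nb[of y] yt ty by auto
qed

text \<open>By \<open>cyc_cases\<close> an element that does not generate \<open>cyc y\<close> is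
  the involution of a group of order 4. Two such elements coincide, and a generator reaches
  everything.\<close>

lemma cyc_joined:
  assumes ord: "ord y \<in> {2, 3, 4, 5}" and y: "y \<in> carrier G"
    and xz: "x \<in> cyc y" "z \<in> cyc y" "x \<noteq> \<one>" "z \<noteq> \<one>"
  shows "x \<in> cyc z \<or> z \<in> cyc x"
  using cyc_cases[OF y ord xz(1,3)] cyc_cases[OF y ord xz(2,4)] xz cyc_self by metis

lemma maximal_planar_imp_cyclic:
  assumes M: "maximal_planar PG"
  shows "cyclic_group G \<and> finite (carrier G) \<and> order G \<le> 5"
proof -
  have P: "planar_graph PG" using M by (simp add: maximal_planar_def)
  have max: "\<not> planar_graph (add_edge y z PG)" if "y \<in> PV" "z \<in> PV" "y \<noteq> z" "{y, z} \<notin> PE" for y z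
    using M that by (simp add: maximal_planar_def)
  have ord: "ord x \<in> {2, 3, 4, 5}" if x: "x \<in> PV" for x
  proof -
    have "ord x \<noteq> 0" "ord x \<le> 6" "ord x \<noteq> 1" using ord_le_6_if_planar[OF P] x ord_eq_1 by auto
    moreover have "ord x \<noteq> 6" using planar_add_edge_order_6[OF P, of x] max x by auto
    ultimately show ?thesis by auto
  qed
  \<comment> \<open>Maximality rules out the edge offered by \<open>planar_add_edge_order_4\<close>,
    so the involution of a cyclic group of order 4 is adjacent only to the two generators.\<close>
  have four: "y = x \<or> y = x [^] (3::nat)" if x: "x \<in> PV" "ord x = 4" and y: "{x [^] (2::nat), y} \<in> PE" for x y
  proof (rule ccontr)
    assume n: "\<not> (y = x \<or> y = x [^] (3::nat))"
    then have "{x, y} \<notin> PE" "planar_graph (add_edge x y PG)"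
      using planar_add_edge_order_4[OF P _ x(2) y] x(1) by auto
    then show False using max[of x y] x(1) y n by (auto simp: PE_iff)
  qed
  \<comment> \<open>Adjacency made reflexive on \<open>PV\<close>. Once transitive, it is an
    equivalence relation there, and its classes are cliques.\<close>
  define adj where "adj x y \<longleftrightarrow> x \<in> PV \<and> y \<in> PV \<and> (x \<in> cyc y \<or> y \<in> cyc x)" for x y
  have adj_iff: "adj x y \<longleftrightarrow> x \<in> PV \<and> y \<in> PV \<and> (x = y \<or> {x, y} \<in> PE)" for x y
    using cyc_self by (auto simp: adj_def PE_iff)
  have adj_sym: "adj x y \<longleftrightarrow> adj y x" for x y by (auto simp: adj_def)
  have trans: "adj x z" if "adj x y" "adj y z" for x y z
  proof -
    have V: "x \<in> PV" "y \<in> PV" "z \<in> PV" using that by (auto simp: adj_def)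
    then have c: "x \<in> carrier G" "y \<in> carrier G" "z \<in> carrier G" by auto
    note o = ord[OF V(1)] ord[OF V(2)] ord[OF V(3)]
    have "x \<in> cyc y \<or> y \<in> cyc x" "y \<in> cyc z \<or> z \<in> cyc y" using that by (auto simp: adj_def)
    then consider "x \<in> cyc y" "y \<in> cyc z" | "x \<in> cyc y" "z \<in> cyc y" | "y \<in> cyc x" "y \<in> cyc z" | "y \<in> cyc x" "z \<in> cyc y"
      by blast
    then have "x \<in> cyc z \<or> z \<in> cyc x"
    proof cases
      case 1 then show ?thesis using cyc_subset c by blast
    next
      case 2 then show ?thesis using cyc_joined o(2) c V by blast
    next
      case 4 then show ?thesis using cyc_subset c by blast
    next
      \<comment> \<open>The obstruction is a common element \<open>y\<close> generating neither
        \<open>cyc x\<close> nor \<open>cyc z\<close>. Then \<open>y\<close> is the involution for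
        an \<open>x\<close> of order 4, and \<open>four\<close> confines its neighbour
        \<open>z\<close> to \<open>cyc x\<close>.\<close>
      case 3
      show ?thesis
      proof (cases "cyc y = cyc x \<or> cyc y = cyc z")
        case True
        then show ?thesis using 3 cyc_subset[of z y] cyc_subset[of x y] c cyc_self by blast
      next
        case False
        then have y: "ord x = 4" "y = x [^] (2::nat)" using cyc_cases[OF c(1) o(1) 3(1)] V by auto
        have "{y, z} \<in> PE" using that(2) False by (auto simp: adj_iff)
        then have "z = x \<or> z = x [^] (3::nat)" using four[OF V(1) y(1)] y(2) by blast
        then show ?thesis using cyc_self pow_in_cyc[OF c(1), of 3] by auto
      qed
    qed
    then show ?thesis using V by (simp add: adj_def)
  qed
  have complete: "adj u w" if uw: "u \<in> PV" "w \<in> PV" for u w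
  proof (rule ccontr)
    assume nadj: "\<not> adj u w"
    show False
    proof (cases "PE = {}")
      case True
      \<comment> \<open>With no edge to attach to, all that planarity gives is an injection of
        \<open>PV\<close> into the plane, and this suffices for drawing one edge.\<close>
      obtain p \<gamma> where "drawing PG p \<gamma>" using planar_graphE[OF P] .
      then have "inj_on p PV" using drawing.inj_p by fastforce
      then have "planar_graph \<lparr>uverts = PV, uedges = {{u, w}}\<rparr>"
        by (rule planar_single_edge) (use uw nadj adj_iff in auto)
      moreover have "add_edge u w PG = \<lparr>uverts = PV, uedges = {{u, w}}\<rparr>"
        by (simp only: add_edge_PG True)
      ultimately show False using max[OF uw] nadj uw adj_iff by auto
    next
      case False
      then obtain v v' where v: "{v, v'} \<in> PE" by (auto simp: proper_power_graph_def)
      then have vv: "adj v v'" "v \<in> PV" "v' \<in> PV" by (auto simp: adj_iff PE_iff)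
      \<comment> \<open>If \<open>u\<close> and \<open>w\<close> were both related to
        \<open>v\<close>, transitivity would relate them to each other; so one of them lies outside
        the class of \<open>v\<close>.\<close>
      obtain x where x: "x \<in> PV" "\<not> adj v x"
        using nadj trans[of u v w] adj_sym uw by blast
      define S where "S = {y. adj x y}"
      have xS: "x \<in> S" and SV: "S \<subseteq> PV" using x by (auto simp: S_def adj_iff)
      \<comment> \<open>The class of \<open>x\<close> fits into one cyclic group, generated by an
        element of order 4 if the class contains one and by \<open>x\<close> otherwise. This yields
        the bound 4 on \<open>card S\<close> that \<open>planar_attach_clique\<close>
        demands.\<close>
      obtain m where m: "m \<in> PV" "S \<subseteq> cyc m - {\<one>}"
      proof (cases "\<exists>m\<in>S. ord m = 4")
        case True
        then obtain m where m: "m \<in> S" "ord m = 4" by blast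
        have "y \<in> cyc m" if "y \<in> S" for y
        proof -
          have "adj m y" using trans[of m x y] m that adj_sym by (auto simp: S_def)
          then show ?thesis using PE_in_cyc_if_ord_ge_4[OF P, of m y] m(2) cyc_self by (auto simp: adj_iff)
        qed
        then show ?thesis using that[of m] m SV by blast
      next
        case no4: False
        have "y \<in> cyc x" if "y \<in> S" for y
        proof -
          have y: "y \<in> PV" "x \<in> cyc y \<or> y \<in> cyc x" using that by (auto simp: S_def adj_def)
          then have "cyc x = cyc y" if "x \<in> cyc y" using cyc_cases[OF _ ord[OF y(1)] that] no4 \<open>y \<in> S\<close> x by auto
          then show ?thesis using y cyc_self by blast
        qed
        then show ?thesis using that[of x] x(1) SV by blast
      qed
      have "card (cyc m) = ord m" using generate_pow_card m(1) by simp
      then have fin: "finite (cyc m)" and "card (cyc m) \<le> 5"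
        using ord[OF m(1)] by (auto intro: card_ge_0_finite)
      moreover have "\<one> \<in> cyc m" by (rule generate.one)
      ultimately have "card (cyc m - {\<one>}) \<le> 4" by simp
      then have S: "finite S" "card S \<le> 4"
        using m(2) fin finite_subset[of S] card_mono[of "cyc m - {\<one>}" S] by auto
      let ?V = "PV - S" and ?E = "{e \<in> PE. e \<subseteq> PV - S}"
      have H0: "planar_graph \<lparr>uverts = ?V, uedges = ?E\<rparr>" by (rule planar_subgraph[OF P]) auto
      \<comment> \<open>The edge \<open>{v, v'}\<close> belongs to another class, so it survives the
        removal of \<open>S\<close>, and the clique can be put back beside it.\<close>
      have "v \<notin> S" using x adj_sym by (auto simp: S_def)
      moreover have "v' \<notin> S" using x vv trans[of v v' x] adj_sym by (auto simp: S_def)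
      ultimately have "{v, v'} \<in> ?E" using v vv by auto
      then have H1: "planar_graph \<lparr>uverts = ?V \<union> S, uedges = insert {v, x} (?E \<union> pairs S)\<rparr>"
        using planar_attach_clique[OF H0 _ S _ xS] by blast
      have "planar_graph \<lparr>uverts = PV, uedges = insert {v, x} PE\<rparr>"
      proof (rule planar_subgraph[OF H1])
        show "PV \<subseteq> uverts \<lparr>uverts = ?V \<union> S, uedges = insert {v, x} (?E \<union> pairs S)\<rparr>" by auto
        have "e \<in> ?E \<union> pairs S" if e: "e \<in> PE" for e
        proof (cases "e \<inter> S = {}")
          case True
          then show ?thesis using e PE_subset[OF e] by auto
        next
          case False
          then obtain a where a: "a \<in> S" "a \<in> e" by blast
          obtain b where b: "e = {a, b}" "{a, b} \<in> PE" using PE_E[OF e a(2)] .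
          then have "adj a b" "a \<noteq> b" by (auto simp: adj_iff PE_iff)
          then have "b \<in> S" using a(1) trans[of x a b] by (simp add: S_def)
          then show ?thesis using a(1) b(1) \<open>a \<noteq> b\<close> by (auto simp: pairs_def)
        qed
        then show "insert {v, x} PE \<subseteq> uedges \<lparr>uverts = ?V \<union> S, uedges = insert {v, x} (?E \<union> pairs S)\<rparr>"
          by auto
        show "e \<subseteq> PV" if "e \<in> insert {v, x} PE" for e using that PE_subset[of e] x vv by auto
      qed
      moreover have "add_edge v x PG = \<lparr>uverts = PV, uedges = insert {v, x} PE\<rparr>"
        by (rule add_edge_PG)
      ultimately show False using max[of v x] vv x adj_iff by auto
    qed
  qed
  obtain m where m: "m \<in> carrier G" "carrier G = cyc m" "ord m \<le> 5" "ord m \<noteq> 0"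
  proof (cases "PV = {}")
    case True
    then have "carrier G = {\<one>}" by auto
    then show ?thesis using that[of \<one>] generate_one by simp
  next
    case False
    then obtain x where x: "x \<in> PV" by blast
    have "\<forall>y. y \<in> PV \<longrightarrow> ord y < 6"
    proof (intro allI impI)
      fix y assume "y \<in> PV"
      from ord[OF this] show "ord y < 6" by auto
    qed
    from ex_has_greatest_nat[of "\<lambda>y. y \<in> PV", OF x this]
    obtain m where m: "m \<in> PV" "\<And>y. y \<in> PV \<Longrightarrow> ord y \<le> ord m" by blast
    have mo: "ord m \<le> 5" "ord m \<noteq> 0" using ord[OF m(1)] by auto
    have "h \<in> cyc m" if h: "h \<in> carrier G" for h
    proof (cases "h = \<one>")
      case True
      then show ?thesis using generate.one by simp
    next
      case False
      then have hV: "h \<in> PV" using h by simp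
      have h0: "ord h \<noteq> 0" using ord[OF hV] by auto
      have "m \<in> cyc h \<or> h \<in> cyc m" using complete[OF m(1) hV] by (simp add: adj_def)
      then show ?thesis
      proof
        \<comment> \<open>Since \<open>m\<close> has greatest order, the orders of \<open>m\<close>
          and \<open>h\<close> agree, and then so do the cyclic groups.\<close>
        assume mh: "m \<in> cyc h"
        then have "ord m \<le> ord h" using ord_dvd_of_cyc[OF h h0] h0 by (simp add: dvd_imp_le)
        then have "cyc m = cyc h" using cyc_eq_if_ord_eq[OF h h0 mh] m(2)[OF hV] by simp
        then show ?thesis using cyc_self by simp
      qed
    qed
    then have "carrier G = cyc m" using cyc_carrier m(1) by blast
    then show ?thesis using that[of m] m(1) mo by blast
  qed
  have "card (carrier G) = ord m" using generate_pow_card[OF m(1)] m(2) by simp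
  then have "finite (carrier G)" "order G \<le> 5" using m(3,4) by (auto simp: order_def intro: card_ge_0_finite)
  moreover have "carrier G = range (\<lambda>n::int. m [^] n)" using m(2) generate_pow[OF m(1)] by auto
  then have "cyclic_group G" using m(1) unfolding cyclic_group by blast
  ultimately show ?thesis by blast
qed

text \<open>There are at most four nontrivial elements, pairwise adjacent by
  \<open>cyc_joined\<close>. Such a complete graph is planar, and no nonadjacent pair is left to be
  tested.\<close>

lemma cyclic_imp_maximal_planar:
  assumes "cyclic_group G" "finite (carrier G)" "order G \<le> 5"
  shows "maximal_planar PG"
proof -
  obtain x where x: "x \<in> carrier G" "carrier G = range (\<lambda>n::int. x [^] n)"
    using assms(1) cyclic_group by blast
  then have cx: "carrier G = cyc x" using generate_pow[OF x(1)] by auto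
  then have o: "ord x = order G" using generate_pow_card[OF x(1)] by (simp add: order_def)
  have "order G > 0" using assms(2) order_gt_0_iff_finite by simp
  have adj: "y \<in> cyc z \<or> z \<in> cyc y" if "y \<in> PV" "z \<in> PV" for y z
  proof -
    have "x \<noteq> \<one>" using that cx generate_one by auto
    then have "ord x \<noteq> 1" using ord_eq_1[OF x(1)] by simp
    then have "ord x \<in> {2, 3, 4, 5}" using o assms(3) \<open>order G > 0\<close> by auto
    then show ?thesis using cyc_joined[of x y z] x(1) that cx by auto
  qed
  have "PE = pairs PV"
    unfolding pairs_def using adj by (auto simp: proper_power_graph_def)
  then have PG: "PG = \<lparr>uverts = PV, uedges = pairs PV\<rparr>" using PG_eq by simp
  have "card PV \<le> 4" using assms(2,3) by (simp add: order_def)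
  then have "planar_graph PG" using planar_complete[of PV] assms(2) PG by simp
  then show ?thesis using adj by (auto simp: maximal_planar_def PE_iff)
qed

end

theorem theorem2p15:
  fixes G :: "('a, 'b) monoid_scheme"
  assumes "group G"
  shows "maximal_planar (proper_power_graph G) \<longleftrightarrow>
           cyclic_group G \<and> finite (carrier G) \<and> order G \<le> 5"
  using group.maximal_planar_imp_cyclic[OF assms] group.cyclic_imp_maximal_planar[OF assms] by blast

end
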